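(* There is an algorithm which, given $n\in\mathbb{N}$, $(a,b)\in\mathbb{N}^{n+1}$ with $\max_{i} a_i\le b$, and an inequality $\alpha^\top x\le\beta$ with $(\alpha,\beta)\in\mathbb{Z}_+^{n+1}$, determines whether $\alpha^\top x\le\beta$ is facet-defining for the knapsack polytope $P=\operatorname{conv}(\{x\in\{0,1\}^n: a^\top x\le b\})$ in time $n^{K+O(1)}$, where $K$ is the number of distinct positive values among the coefficients $\alpha_1,\dots,\alpha_n$.
   Context: $\mathbb{N}=\{1,2,\dots\}$ and $\mathbb{Z}_+$ is the set of nonnegative integers. $K=|\{\alpha_i:\alpha_i>0,\ i\in\{1,\dots,n\}\}|$. Running time is measured assuming that each arithmetic operation takes $O(1)$ time. The $O(1)$ in the exponent is an absolute constant: the running time is bounded by $C n^{K+c}$ with $C,c$ independent of the input (in particular of $n$ and $K$). An inequality is facet-defining for a polytope $P$ if it is valid for $P$ and the face of $P$ on which it holds with equality has dimension $\dim(P)-1$. Under the assumption $\max_i a_i\le b$ the polytope $P$ is full-dimensional. *)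

theory Defs
  imports "HOL-Analysis.Analysis" "HOL-Analysis.Finite_Function_Topology"
begin

section \<open>The knapsack polytope\<close>

text \<open>
  The dimension \<open>n\<close> is part of the input of one fixed program, so it cannot be a type.
  We realise \<open>\<real>\<^sup>n\<close> as the subspace of those \<open>x :: nat \<Rightarrow>\<^sub>0 real\<close> whose support lies in
  \<open>{..<n}\<close>; coordinates are numbered from \<open>0\<close>.
\<close>

type_synonym point = "nat \<Rightarrow>\<^sub>0 real"

definition lin_form :: "nat \<Rightarrow> (nat \<Rightarrow> nat) \<Rightarrow> point \<Rightarrow> real" where
  "lin_form n c x = (\<Sum>i<n. real (c i) * Poly_Mapping.lookup x i)"

definition knapsack_points :: "nat \<Rightarrow> (nat \<Rightarrow> nat) \<Rightarrow> nat \<Rightarrow> point set" where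
  "knapsack_points n a b =
     {x. Poly_Mapping.keys x \<subseteq> {..<n} \<and> (\<forall>i<n. Poly_Mapping.lookup x i \<in> {0, 1})
         \<and> lin_form n a x \<le> real b}"

definition knapsack_polytope :: "nat \<Rightarrow> (nat \<Rightarrow> nat) \<Rightarrow> nat \<Rightarrow> point set" where
  "knapsack_polytope n a b = convex hull (knapsack_points n a b)"

text \<open>
  The library's \<open>aff_dim\<close> is restricted to \<open>euclidean_space\<close>, of which \<open>nat \<Rightarrow>\<^sub>0 real\<close> is not an
  instance. The definition below is the library's, with the finiteness of \<open>B\<close> (automatic in
  a Euclidean space) made explicit; in particular the empty set has dimension \<open>-1\<close>.
\<close>

definition affine_dim :: "'a::real_vector set \<Rightarrow> int" where
  "affine_dim V = (SOME d :: int. \<exists>B. finite B \<and> affine hull B = affine hull V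
     \<and> \<not> affine_dependent B \<and> of_nat (card B) = d + 1)"

lemma affine_dim_eq_aff_dim:
  fixes V :: "'a::euclidean_space set"
  shows "affine_dim V = aff_dim V"
proof -
  have "(finite B \<and> affine hull B = affine hull V \<and> \<not> affine_dependent B \<and> int (card B) = d + 1)
      = (affine hull B = affine hull V \<and> \<not> affine_dependent B \<and> int (card B) = d + 1)"
    for B :: "'a set" and d
    using aff_independent_finite by blast
  then show ?thesis
    unfolding affine_dim_def aff_dim_def by simp
qed

definition valid_for :: "nat \<Rightarrow> (nat \<Rightarrow> nat) \<Rightarrow> nat \<Rightarrow> point set \<Rightarrow> bool" where
  "valid_for n \<alpha> \<beta> P \<longleftrightarrow> (\<forall>x\<in>P. lin_form n \<alpha> x \<le> real \<beta>)"

definition facet_defining :: "nat \<Rightarrow> (nat \<Rightarrow> nat) \<Rightarrow> nat \<Rightarrow> point set \<Rightarrow> bool" where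
  "facet_defining n \<alpha> \<beta> P \<longleftrightarrow>
     valid_for n \<alpha> \<beta> P \<and> affine_dim {x \<in> P. lin_form n \<alpha> x = real \<beta>} = affine_dim P - 1"

definition num_pos_values :: "nat \<Rightarrow> (nat \<Rightarrow> nat) \<Rightarrow> nat" where
  "num_pos_values n \<alpha> = card {\<alpha> i | i. i < n \<and> \<alpha> i > 0}"

section \<open>Unit-cost random access machine\<close>

text \<open>
  Algorithms are programs of a small imperative language over integers. The memory consists of
  named arrays with computed indices; a scalar variable \<open>x\<close> is cell \<open>0\<close> of array \<open>x\<close>. A program
  mentions only finitely many names, so this is a random access machine with indirect addressing.
  Every arithmetic operation, comparison, Boolean operation, memory access and constant costs one
  time unit, irrespective of the size of the numbers. Rational arithmetic is available with
  constant overhead through numerator/denominator pairs. Rounding division and bit operations are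
  deliberately not primitive: at unit cost they would make the model unreasonably powerful.
\<close>

type_synonym state = "string \<Rightarrow> int \<Rightarrow> int"

datatype aexp =
    Const int
  | Read string aexp
  | Plus aexp aexp
  | Minus aexp aexp
  | Times aexp aexp

datatype bexp =
    Less aexp aexp
  | Equal aexp aexp
  | Neg bexp
  | Conj bexp bexp

datatype com =
    Skip
  | Assign string aexp aexp
  | Seq com com
  | Cond bexp com com
  | While bexp com

fun aval :: "state \<Rightarrow> aexp \<Rightarrow> int" where
  "aval s (Const k) = k"
| "aval s (Read x e) = s x (aval s e)"
| "aval s (Plus e f) = aval s e + aval s f"
| "aval s (Minus e f) = aval s e - aval s f"
| "aval s (Times e f) = aval s e * aval s f"

fun acost :: "aexp \<Rightarrow> nat" where
  "acost (Const k) = 1"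
| "acost (Read x e) = acost e + 1"
| "acost (Plus e f) = acost e + acost f + 1"
| "acost (Minus e f) = acost e + acost f + 1"
| "acost (Times e f) = acost e + acost f + 1"

fun bval :: "state \<Rightarrow> bexp \<Rightarrow> bool" where
  "bval s (Less e f) \<longleftrightarrow> aval s e < aval s f"
| "bval s (Equal e f) \<longleftrightarrow> aval s e = aval s f"
| "bval s (Neg g) \<longleftrightarrow> \<not> bval s g"
| "bval s (Conj g h) \<longleftrightarrow> bval s g \<and> bval s h"

fun bcost :: "bexp \<Rightarrow> nat" where
  "bcost (Less e f) = acost e + acost f + 1"
| "bcost (Equal e f) = acost e + acost f + 1"
| "bcost (Neg g) = bcost g + 1"
| "bcost (Conj g h) = bcost g + bcost h + 1"

text \<open>
  \<open>exec p s t s'\<close>: started in state \<open>s\<close>, program \<open>p\<close> terminates in state \<open>s'\<close> after exactly \<open>t\<close>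
  time units. The command \<open>Assign x i e\<close> stores the value of \<open>e\<close> in cell \<open>i\<close> of array \<open>x\<close>.
\<close>

inductive exec :: "com \<Rightarrow> state \<Rightarrow> nat \<Rightarrow> state \<Rightarrow> bool" where
  Skip: "exec Skip s 1 s"
| Assign: "exec (Assign x i e) s (acost i + acost e + 1)
             (s(x := (s x)(aval s i := aval s e)))"
| Seq: "exec p s t s' \<Longrightarrow> exec q s' u s'' \<Longrightarrow> exec (Seq p q) s (t + u) s''"
| CondTrue: "bval s g \<Longrightarrow> exec p s t s' \<Longrightarrow> exec (Cond g p q) s (bcost g + 1 + t) s'"
| CondFalse: "\<not> bval s g \<Longrightarrow> exec q s t s' \<Longrightarrow> exec (Cond g p q) s (bcost g + 1 + t) s'"
| WhileFalse: "\<not> bval s g \<Longrightarrow> exec (While g p) s (bcost g + 1) s"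
| WhileTrue: "bval s g \<Longrightarrow> exec p s t s' \<Longrightarrow> exec (While g p) s' u s''
    \<Longrightarrow> exec (While g p) s (bcost g + 1 + t + u) s''"

inductive_cases exec_SkipE: "exec Skip s t s'"
inductive_cases exec_AssignE: "exec (Assign x i e) s t s'"
inductive_cases exec_SeqE: "exec (Seq p q) s t s'"
inductive_cases exec_CondE: "exec (Cond g p q) s t s'"
inductive_cases exec_WhileE: "exec (While g p) s t s'"

lemma exec_deterministic:
  "exec p s t s' \<Longrightarrow> exec p s u s'' \<Longrightarrow> u = t \<and> s'' = s'"
proof (induction arbitrary: u s'' rule: exec.induct)
  case (Skip s) then show ?case by (auto elim: exec_SkipE)
next
  case (Assign x i e s) then show ?case by (auto elim: exec_AssignE)
next
  case (Seq p s t s' q u s'') then show ?case by (blast elim: exec_SeqE)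
next
  case (CondTrue s g p t s' q v r)
  from CondTrue.prems CondTrue.hyps(1) obtain t1
    where *: "v = bcost g + 1 + t1" "exec p s t1 r"
    by (auto elim: exec_CondE)
  from CondTrue.IH[OF *(2)] *(1) show ?case by simp
next
  case (CondFalse s g q t s' p v r)
  from CondFalse.prems CondFalse.hyps(1) obtain t1
    where *: "v = bcost g + 1 + t1" "exec q s t1 r"
    by (auto elim: exec_CondE)
  from CondFalse.IH[OF *(2)] *(1) show ?case by simp
next
  case (WhileFalse s g p v r)
  from WhileFalse.prems show ?case
    by (rule exec_WhileE) (use WhileFalse.hyps(1) in simp_all)
next
  case (WhileTrue s g p t s' u s'' v r)
  from WhileTrue.prems WhileTrue.hyps(1) obtain t1 s1 u1
    where *: "v = bcost g + 1 + t1 + u1" "exec p s t1 s1" "exec (While g p) s1 u1 r"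
    by (auto elim: exec_WhileE)
  from WhileTrue.IH(1)[OF *(2)] WhileTrue.IH(2) *(1,3) show ?case by simp
qed

text \<open>
  All memory cells that do not hold an entry of \<open>(n, a, b, \<alpha>, \<beta>)\<close> are initially \<open>0\<close>; the values
  of \<open>a\<close> and \<open>\<alpha>\<close> at indices \<open>\<ge> n\<close> are not part of the input.
\<close>

definition scalar :: "nat \<Rightarrow> int \<Rightarrow> int" where
  "scalar k = (\<lambda>j. if j = 0 then int k else 0)"

definition vector :: "nat \<Rightarrow> (nat \<Rightarrow> nat) \<Rightarrow> int \<Rightarrow> int" where
  "vector n v = (\<lambda>j. if 0 \<le> j \<and> j < int n then int (v (nat j)) else 0)"

definition input_state ::
    "nat \<Rightarrow> (nat \<Rightarrow> nat) \<Rightarrow> nat \<Rightarrow> (nat \<Rightarrow> nat) \<Rightarrow> nat \<Rightarrow> state" where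
  "input_state n a b \<alpha> \<beta> = (\<lambda>_ _. 0)
     (''n'' := scalar n, ''a'' := vector n a, ''b'' := scalar b,
      ''alpha'' := vector n \<alpha>, ''beta'' := scalar \<beta>)"

definition output_of :: "state \<Rightarrow> int" where
  "output_of s = s ''result'' 0"

end

theory Submission
  imports Defs
begin

text \<open>
  Adding a coordinate that is constantly \<open>1\<close> turns affine dimension into linear dimension, so a
  valid inequality is facet-defining iff the lifted \<open>0/1\<close> points of its face span a space of
  dimension \<open>n\<close>.

  Call two items equivalent if they have the same positive coefficient \<open>\<alpha>\<^sub>i\<close>. A \<open>0/1\<close> point has the
  same value of \<open>\<alpha>\<close> as any other point with the same number of items from every class, and among
  these the lightest one takes the lightest items of each class; call such a point canonical.
  There are at most \<open>2 n\<^sup>K\<close> vectors of class counts. If \<open>y\<close> is any feasible point and \<open>x\<close> the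
  canonical point with the same counts, then \<open>y - x\<close> is a sum of exchanges of an item of \<open>x\<close> for a heavier one of
  the same class and of insertions of items with \<open>\<alpha>\<^sub>i = 0\<close>, and each of these moves applied to \<open>x\<close>
  alone stays feasible. Hence it suffices to examine the canonical points and the points that differ
  from one of them in at most two coordinates.

  The program runs through the canonical points like an odometer, tests validity on the nearby points,
  and computes the rank of those on the face by division-free elimination.
\<close>

section \<open>Facets through lifted points\<close>

text \<open>A single move applied to \<open>x\<close> stays feasible because no move lowers the
  weight and \<open>x\<close> together with all moves is the feasible \<open>y\<close>. Exchanges
  stay inside a class and insertions have coefficient 0, so a move also keeps the value of
  \<open>\<alpha>\<close>: if \<open>y\<close> lies on the face, so do all points used to express
  it. The program knows neither \<open>K\<close> nor the classes. It keeps only the current set and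
  finds the next one by comparing entries of \<open>\<alpha>\<close> and \<open>a\<close>. The
  number of rounds is controlled in the proof alone: class counts are the digits of a mixed radix
  numeral, one step raises this numeral by exactly one, and its largest value belongs to the set of
  all items with positive coefficient. As the machine has no division, elimination multiplies
  crosswise; the entries grow, which unit cost does not charge.\<close>

definition lift :: "nat \<Rightarrow> point \<Rightarrow> point" where
  "lift n x = x + Poly_Mapping.single n 1"

definition coord_space :: "nat \<Rightarrow> point set" where
  "coord_space n = {x. Poly_Mapping.keys x \<subseteq> {..<n}}"

lemma coord_space_iff: "x \<in> coord_space n \<longleftrightarrow> (\<forall>i\<ge>n. Poly_Mapping.lookup x i = 0)"
  unfolding coord_space_def by (auto simp: in_keys_iff not_less subset_iff)
     (metis linorder_not_less)

lemma lookup_lift: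
  "Poly_Mapping.lookup (lift n x) i = Poly_Mapping.lookup x i + (if i = n then 1 else 0)"
  by (simp add: lift_def lookup_add lookup_single when_def)

lemma lookup_scaleR [simp]:
  "Poly_Mapping.lookup (r *\<^sub>R x) i = r * Poly_Mapping.lookup (x :: 'a \<Rightarrow>\<^sub>0 real) i"
proof -
  have "finite {i. r * Poly_Mapping.lookup x i \<noteq> 0}"
    by (rule finite_subset[OF _ finite_lookup[of x]]) auto
  then show ?thesis by (simp add: scaleR_poly_mapping_def)
qed

lemma lookup_sum_single:
  assumes "finite S"
  shows "Poly_Mapping.lookup (\<Sum>i\<in>S. c i *\<^sub>R Poly_Mapping.single i (1::real)) j
    = (if j \<in> S then c j else 0)"
  using assms by (induction S) (auto simp: lookup_add lookup_single when_def)

lemma subspace_coord_space: "subspace (coord_space n)"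
  by (auto simp: subspace_def coord_space_iff lookup_add)

lemma inj_lift: "inj (lift n)"
  by (auto simp: inj_def lift_def)

lemma coord_space_eq_span: "coord_space n = span ((\<lambda>i. Poly_Mapping.single i 1) ` {..<n})"
proof
  show "coord_space n \<subseteq> span ((\<lambda>i. Poly_Mapping.single i 1) ` {..<n})"
  proof
    fix x assume x: "x \<in> coord_space n"
    have "x = (\<Sum>i<n. Poly_Mapping.lookup x i *\<^sub>R Poly_Mapping.single i 1)"
      using x by (intro poly_mapping_eqI) (simp add: lookup_sum_single coord_space_iff)
    also have "\<dots> \<in> span ((\<lambda>i. Poly_Mapping.single i 1) ` {..<n})"
      by (intro span_sum span_scale span_base) auto
    finally show "x \<in> span ((\<lambda>i. Poly_Mapping.single i 1) ` {..<n})" .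
  qed
  show "span ((\<lambda>i. Poly_Mapping.single i 1) ` {..<n}) \<subseteq> coord_space n"
    by (rule span_minimal[OF _ subspace_coord_space])
      (auto simp: coord_space_iff lookup_single when_def)
qed

section \<open>Affine hull, affine independence and dimension under lifting\<close>

lemma lift_sum:
  assumes "sum u T = 1"
  shows "lift n (\<Sum>v\<in>T. u v *\<^sub>R v) = (\<Sum>v\<in>T. u v *\<^sub>R lift n v)"
  using assms by (simp add: lift_def scaleR_add_right sum.distrib flip: scaleR_sum_left)

text \<open>Coordinate \<open>n\<close> is 0 on \<open>coord_space n\<close> and 1 after lifting. So
  if a combination of lifted points is again a lifted point, comparing this coordinate shows that
  its coefficients sum to 1: it is an affine combination.\<close>

lemma affine_hull_eq_lift:
  assumes "V \<subseteq> coord_space n"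
  shows "affine hull V = {x \<in> coord_space n. lift n x \<in> span (lift n ` V)}"
proof
  have "affine {x \<in> coord_space n. lift n x \<in> span (lift n ` V)}"
  proof (unfold affine_def, clarify, intro conjI)
    fix x y :: point and u v :: real assume xy: "x \<in> coord_space n" "y \<in> coord_space n"
      "lift n x \<in> span (lift n ` V)" "lift n y \<in> span (lift n ` V)" "u + v = 1"
    show "u *\<^sub>R x + v *\<^sub>R y \<in> coord_space n"
      using xy subspace_coord_space by (simp add: subspace_add subspace_scale)
    have "lift n (u *\<^sub>R x + v *\<^sub>R y) = u *\<^sub>R lift n x + v *\<^sub>R lift n y"
      using xy(5) by (simp add: lift_def algebra_simps flip: scaleR_add_left)
    then show "lift n (u *\<^sub>R x + v *\<^sub>R y) \<in> span (lift n ` V)"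
      using xy by (simp add: span_add span_scale)
  qed
  then show "affine hull V \<subseteq> {x \<in> coord_space n. lift n x \<in> span (lift n ` V)}"
    by (intro hull_minimal) (use assms in \<open>auto intro: span_base\<close>)
  show "{x \<in> coord_space n. lift n x \<in> span (lift n ` V)} \<subseteq> affine hull V"
  proof clarify
    fix x assume x: "x \<in> coord_space n" "lift n x \<in> span (lift n ` V)"
    then obtain T r where T: "finite T" "T \<subseteq> lift n ` V" "lift n x = (\<Sum>a\<in>T. r a *\<^sub>R a)"
      unfolding span_explicit by auto
    obtain U where U: "U \<subseteq> V" "T = lift n ` U" using T(2) by (meson subset_imageE)
    have inj: "inj_on (lift n) U" using inj_lift by (rule inj_on_subset) simp
    have fin: "finite U" using T(1) U(2) inj finite_imageD by blast
    define u where "u v = r (lift n v)" for v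
    have eq: "lift n x = (\<Sum>v\<in>U. u v *\<^sub>R lift n v)"
      unfolding T(3) U(2) u_def by (simp add: sum.reindex[OF inj])
    have "1 = Poly_Mapping.lookup (lift n x) n"
      using x by (simp add: lookup_lift coord_space_iff)
    also have "\<dots> = (\<Sum>v\<in>U. u v * Poly_Mapping.lookup (lift n v) n)"
      unfolding eq by (simp add: lookup_sum)
    also have "\<dots> = sum u U"
      using U(1) assms by (intro sum.cong refl) (auto simp: lookup_lift coord_space_iff)
    finally have 1: "sum u U = 1" by simp
    have "x = (\<Sum>v\<in>U. u v *\<^sub>R v)"
      by (rule injD[OF inj_lift[of n]]) (simp only: eq lift_sum[OF 1])
    moreover have "U \<noteq> {}" using 1 by auto
    ultimately have "\<exists>S u. finite S \<and> S \<noteq> {} \<and> S \<subseteq> V \<and> sum u S = 1 \<and> (\<Sum>v\<in>S. u v *\<^sub>R v) = x"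
      using 1 U(1) fin by (intro exI[of _ U] exI[of _ u]) simp
    then show "x \<in> affine hull V"
      unfolding affine_hull_explicit by (rule CollectI)
  qed
qed

text \<open>Coordinate \<open>n\<close> of a vanishing combination of lifted points says that the
  coefficients sum to 0, which is the side condition in affine dependence.\<close>

lemma affine_dependent_iff_lift:
  assumes "B \<subseteq> coord_space n"
  shows "affine_dependent B \<longleftrightarrow> dependent (lift n ` B)"
proof
  assume "affine_dependent B"
  then obtain S u where S: "finite S" "S \<subseteq> B" "sum u S = 0" "\<exists>v\<in>S. u v \<noteq> 0"
    "(\<Sum>v\<in>S. u v *\<^sub>R v) = 0" unfolding affine_dependent_explicit by auto
  have inj: "inj_on (lift n) S" using inj_lift by (rule inj_on_subset) simp
  \<comment> \<open>Subtracting \<open>single n 1\<close> undoes \<open>lift\<close>; this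
    transports the coefficients from \<open>S\<close> to its image.\<close>
  have "(\<Sum>v\<in>lift n ` S. u (v - Poly_Mapping.single n 1) *\<^sub>R v) = (\<Sum>v\<in>S. u v *\<^sub>R lift n v)"
    by (simp add: sum.reindex[OF inj]) (simp add: lift_def)
  also have "\<dots> = 0"
    using S by (simp add: lift_def scaleR_add_right sum.distrib flip: scaleR_sum_left)
  finally have "(\<Sum>v\<in>lift n ` S. u (v - Poly_Mapping.single n 1) *\<^sub>R v) = 0" .
  moreover have "\<exists>v\<in>lift n ` S. u (v - Poly_Mapping.single n 1) \<noteq> 0"
    using S(4) by (simp add: lift_def)
  ultimately show "dependent (lift n ` B)"
    unfolding dependent_explicit using S(1,2)
    by (intro exI[of _ "lift n ` S"] exI[of _ "\<lambda>v. u (v - Poly_Mapping.single n 1)"]) auto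
next
  assume "dependent (lift n ` B)"
  then obtain T r where T: "finite T" "T \<subseteq> lift n ` B" "(\<Sum>a\<in>T. r a *\<^sub>R a) = 0" "\<exists>v\<in>T. r v \<noteq> 0"
    unfolding dependent_explicit by auto
  obtain U where U: "U \<subseteq> B" "T = lift n ` U" using T(2) by (meson subset_imageE)
  have inj: "inj_on (lift n) U" using inj_lift by (rule inj_on_subset) simp
  have fin: "finite U" using T(1) U(2) inj finite_imageD by blast
  define u where "u v = r (lift n v)" for v
  have eq: "(\<Sum>v\<in>U. u v *\<^sub>R lift n v) = 0"
    using T(3) unfolding U(2) u_def by (simp add: sum.reindex[OF inj])
  have "0 = Poly_Mapping.lookup (\<Sum>v\<in>U. u v *\<^sub>R lift n v) n"
    unfolding eq by simp
  also have "\<dots> = (\<Sum>v\<in>U. u v * Poly_Mapping.lookup (lift n v) n)"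
    by (simp add: lookup_sum)
  also have "\<dots> = sum u U"
    using U(1) assms by (intro sum.cong refl) (auto simp: lookup_lift coord_space_iff)
  finally have 0: "sum u U = 0" by simp
  then have "(\<Sum>v\<in>U. u v *\<^sub>R v) = 0"
    using eq by (simp add: lift_def scaleR_add_right sum.distrib flip: scaleR_sum_left)
  then show "affine_dependent B"
    unfolding affine_dependent_explicit using 0 T(4) U fin by (auto simp: u_def)
qed

text \<open>\<open>affine_dim\<close> is defined by choice, so its value must be shown to exist and
  to be unique. A linear basis chosen among the lifted points is the lift of an affine basis of
  \<open>V\<close>; conversely every affine basis lifts to a basis of the same span, which fixes its
  cardinality.\<close>

lemma affine_dim_eq_dim_lift:
  assumes V: "V \<subseteq> coord_space n"
  shows "affine_dim V = int (dim (lift n ` V)) - 1"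
proof -
  let ?P = "\<lambda>d :: int. \<exists>B. finite B \<and> affine hull B = affine hull V
     \<and> \<not> affine_dependent B \<and> of_nat (card B) = d + 1"
  have sub: "coord_space n \<subseteq> coord_space (Suc n)" for n
    by (auto simp: coord_space_iff)
  have "x \<in> coord_space n \<Longrightarrow> lift n x \<in> coord_space (Suc n)" for x
    by (auto simp: coord_space_iff lookup_lift)
  then have lV: "lift n ` V \<subseteq> span ((\<lambda>i. Poly_Mapping.single i 1) ` {..<Suc n})"
    using V unfolding coord_space_eq_span[symmetric] by blast
  \<comment> \<open>The ambient space has infinite dimension; finiteness comes from the finitely
    many coordinates that lifted points use.\<close>
  have fin: "finite B" if "independent B" "B \<subseteq> lift n ` V" for B
    using independent_span_bound[of "(\<lambda>i. Poly_Mapping.single i 1) ` {..<Suc n}" B] that lV by auto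
  obtain C where C: "C \<subseteq> lift n ` V" "independent C" "lift n ` V \<subseteq> span C"
    "card C = dim (lift n ` V)"
    using basis_exists[of "lift n ` V"] by metis
  obtain B where B: "B \<subseteq> V" "C = lift n ` B" using C(1) by (meson subset_imageE)
  have inj: "inj_on (lift n) B" for B using inj_lift by (rule inj_on_subset) simp
  have Bc: "B \<subseteq> coord_space n" using B V by auto
  have spC: "span C = span (lift n ` V)"
    using C by (meson span_minimal span_mono subset_antisym subspace_span)
  have "?P (int (dim (lift n ` V)) - 1)"
  proof (intro exI[of _ B] conjI)
    show "finite B" using fin[OF C(2,1)] B(2) inj finite_imageD by blast
    show "affine hull B = affine hull V"
      unfolding affine_hull_eq_lift[OF V] affine_hull_eq_lift[OF Bc] using spC B(2) by simp
    show "\<not> affine_dependent B"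
      using C(2) B(2) affine_dependent_iff_lift[OF Bc] by simp
    show "int (card B) = int (dim (lift n ` V)) - 1 + 1"
      using C(4) B(2) inj by (simp add: card_image)
  qed
  moreover have "d = int (dim (lift n ` V)) - 1" if "?P d" for d
  proof -
    from that obtain B where B: "finite B" "affine hull B = affine hull V"
      "\<not> affine_dependent B" "int (card B) = d + 1" by auto
    have hV: "affine hull V \<subseteq> coord_space n"
      using affine_hull_eq_lift[OF V] by auto
    have Bc: "B \<subseteq> coord_space n" using hull_subset[of B affine] B(2) hV by auto
    have "lift n ` B \<subseteq> span (lift n ` V)" "lift n ` V \<subseteq> span (lift n ` B)"
      using hull_subset[of B affine] hull_subset[of V affine] B(2)
        affine_hull_eq_lift[OF V] affine_hull_eq_lift[OF Bc] by auto
    then have "span (lift n ` B) = span (lift n ` V)"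
      by (meson span_minimal subset_antisym subspace_span)
    then have "dim (lift n ` V) = card (lift n ` B)"
      using B(3) affine_dependent_iff_lift[OF Bc] by (intro dim_eq_card) auto
    then show ?thesis using B(4) inj by (simp add: card_image)
  qed
  ultimately show ?thesis unfolding affine_dim_def by (rule some_equality)
qed

section \<open>0/1 points as sets of items\<close>

definition char_vec :: "nat set \<Rightarrow> point" where
  "char_vec Y = (\<Sum>i\<in>Y. Poly_Mapping.single i 1)"

lemma lookup_char_vec:
  "finite Y \<Longrightarrow> Poly_Mapping.lookup (char_vec Y) i = (if i \<in> Y then 1 else 0)"
  using lookup_sum_single[of Y "\<lambda>_. 1" i] by (simp add: char_vec_def)

lemma lin_form_char_vec:
  assumes "Y \<subseteq> {..<n}"
  shows "lin_form n c (char_vec Y) = real (sum c Y)"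
proof -
  have f: "finite Y" using assms finite_subset by blast
  have "lin_form n c (char_vec Y) = (\<Sum>i<n. if i \<in> Y then real (c i) else 0)"
    by (auto simp: lin_form_def lookup_char_vec[OF f] intro!: sum.cong)
  also have "\<dots> = (\<Sum>i\<in>Y. real (c i))"
    using assms by (simp add: sum.If_cases Int_absorb1)
  finally show ?thesis by simp
qed

lemma char_vec_in_coord_space: "Y \<subseteq> {..<n} \<Longrightarrow> char_vec Y \<in> coord_space n"
  using finite_subset[of Y "{..<n}"] by (auto simp: coord_space_iff lookup_char_vec)

definition feasible_sets :: "nat \<Rightarrow> (nat \<Rightarrow> nat) \<Rightarrow> nat \<Rightarrow> nat set set" where
  "feasible_sets n a b = {Y. Y \<subseteq> {..<n} \<and> sum a Y \<le> b}"

lemma knapsack_points_eq: "knapsack_points n a b = char_vec ` feasible_sets n a b"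
proof (intro equalityI subsetI)
  fix x assume x: "x \<in> knapsack_points n a b"
  define Y where "Y = {i. i < n \<and> Poly_Mapping.lookup x i = 1}"
  have "x = char_vec Y"
    using x by (intro poly_mapping_eqI)
      (auto simp: knapsack_points_def Y_def lookup_char_vec in_keys_iff subset_iff)
  moreover have "Y \<subseteq> {..<n}" by (auto simp: Y_def)
  moreover have "sum a Y \<le> b"
    using x calculation by (simp add: knapsack_points_def lin_form_char_vec del: of_nat_sum)
  ultimately show "x \<in> char_vec ` feasible_sets n a b"
    by (simp add: feasible_sets_def)
next
  fix x assume "x \<in> char_vec ` feasible_sets n a b"
  then show "x \<in> knapsack_points n a b"
    using char_vec_in_coord_space finite_subset[of _ "{..<n}"]
    by (auto simp: knapsack_points_def feasible_sets_def lin_form_char_vec lookup_char_vec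
        coord_space_def simp flip: of_nat_sum)
qed

section \<open>Faces of convex hulls\<close>

lemma lin_form_combine:
  "lin_form n c (u *\<^sub>R x + v *\<^sub>R y) = u * lin_form n c x + v * lin_form n c y"
  by (simp add: lin_form_def lookup_add algebra_simps sum.distrib sum_distrib_left)

text \<open>A convex combination with positive weight on a point strictly below level
  \<open>r\<close> stays strictly below. Hence the points below \<open>r\<close> together with the
  hull of the points on level \<open>r\<close> form a convex set. It contains \<open>S\<close>, so
  the hull of \<open>S\<close> gains nothing more on the level.\<close>

lemma hull_face_eq:
  assumes "\<And>x. x \<in> S \<Longrightarrow> lin_form n c x \<le> r"
  shows "{x \<in> convex hull S. lin_form n c x = r} = convex hull {x \<in> S. lin_form n c x = r}"
proof
  let ?F = "{x \<in> S. lin_form n c x = r}"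
  have "convex {x. lin_form n c x = r}"
    by (auto simp: convex_def lin_form_combine simp flip: distrib_right)
  then have F: "convex hull ?F \<subseteq> {x. lin_form n c x = r}"
    by (intro hull_minimal) auto
  moreover have "convex hull ?F \<subseteq> convex hull S" by (intro hull_mono) auto
  ultimately show "convex hull ?F \<subseteq> {x \<in> convex hull S. lin_form n c x = r}" by auto
  have strict: "u * p + v * q < r"
    if "p < r" "q \<le> r" "0 < u" "0 \<le> v" "u + v = 1" for p q u v :: real
  proof -
    have "u * p + v * q < u * r + v * r"
      using that by (intro add_less_le_mono mult_strict_left_mono mult_left_mono) auto
    also have "\<dots> = r" using that by (simp flip: distrib_right)
    finally show ?thesis .
  qed
  have "convex ({x. lin_form n c x < r} \<union> convex hull ?F)" (is "convex ?G")
  proof (rule convexI)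
    fix x y and u v :: real
    assume xy: "x \<in> ?G" "y \<in> ?G" "0 \<le> u" "0 \<le> v" "u + v = 1"
    have le: "z \<in> ?G \<Longrightarrow> lin_form n c z \<le> r" for z using F by auto
    consider "u = 0" | "v = 0" | "u > 0" "v > 0" using xy by linarith
    then show "u *\<^sub>R x + v *\<^sub>R y \<in> ?G"
    proof cases
      case 3
      show ?thesis
      proof (cases "lin_form n c x < r \<or> lin_form n c y < r")
        case True
        then have "lin_form n c (u *\<^sub>R x + v *\<^sub>R y) < r"
          unfolding lin_form_combine
          using strict[of "lin_form n c x" "lin_form n c y" u v]
            strict[of "lin_form n c y" "lin_form n c x" v u] 3 xy le[of x] le[of y] by linarith
        then show ?thesis by simp
      next
        case False
        then have "x \<in> convex hull ?F" "y \<in> convex hull ?F" using xy by auto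
        then show ?thesis using convexD[OF convex_convex_hull] xy by blast
      qed
    qed (use xy in auto)
  qed
  moreover have "S \<subseteq> ?G" using assms hull_subset[of ?F convex] by fastforce
  ultimately have "convex hull S \<subseteq> ?G" by (rule hull_minimal[rotated])
  then show "{x \<in> convex hull S. lin_form n c x = r} \<subseteq> convex hull ?F" by auto
qed

definition lifted_char_vec :: "nat \<Rightarrow> nat set \<Rightarrow> point" where
  "lifted_char_vec n Y = lift n (char_vec Y)"

text \<open>The convex hull lies between the points and their affine hull, so its lifts span no more
  than the lifts of the points.\<close>

lemma affine_dim_hull_char_vec:
  assumes "\<And>Y. Y \<in> F \<Longrightarrow> Y \<subseteq> {..<n}"
  shows "affine_dim (convex hull (char_vec ` F)) = int (dim (lifted_char_vec n ` F)) - 1"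
proof -
  let ?V = "char_vec ` F"
  have V: "?V \<subseteq> coord_space n" using assms char_vec_in_coord_space by blast
  have H: "convex hull ?V \<subseteq> affine hull ?V" by (rule convex_hull_subset_affine_hull)
  have A: "affine hull ?V = {x \<in> coord_space n. lift n x \<in> span (lift n ` ?V)}"
    by (rule affine_hull_eq_lift[OF V])
  have "lift n ` (convex hull ?V) \<subseteq> span (lift n ` ?V)" using H A by auto
  moreover have "lift n ` ?V \<subseteq> span (lift n ` (convex hull ?V))"
    using hull_subset[of ?V convex] by (auto intro: span_base)
  ultimately have "span (lift n ` (convex hull ?V)) = span (lift n ` ?V)"
    by (meson span_minimal subset_antisym subspace_span)
  then have "dim (lift n ` (convex hull ?V)) = dim (lift n ` ?V)"
    by (metis dim_span)
  then show ?thesis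
    using affine_dim_eq_dim_lift[of "convex hull ?V" n] H A
    by (auto simp: lifted_char_vec_def image_image)
qed

section \<open>Dimension of the polytope and the facet criterion\<close>

lemma independent_unit_vectors: "independent ((\<lambda>i. Poly_Mapping.single i (1::real)) ` S)"
proof -
  have "\<not> dependent (range (\<lambda>i::'a. Poly_Mapping.single i (1::real)))"
  proof
    assume "dependent (range (\<lambda>i::'a. Poly_Mapping.single i (1::real)))"
    then obtain T :: "('a \<Rightarrow>\<^sub>0 real) set" and u v where T: "finite T" "T \<subseteq> range (\<lambda>i. Poly_Mapping.single i 1)"
      "(\<Sum>v\<in>T. u v *\<^sub>R v) = 0" "v \<in> T" "u v \<noteq> 0"
      unfolding dependent_explicit by auto
    then obtain i where i: "v = Poly_Mapping.single i 1" by auto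
    have "0 = Poly_Mapping.lookup (\<Sum>v\<in>T. u v *\<^sub>R v) i" using T by simp
    also have "\<dots> = (\<Sum>w\<in>T. if w = v then u w else 0)"
      unfolding lookup_sum
    proof (intro sum.cong refl)
      fix w assume "w \<in> T"
      then obtain j where "w = Poly_Mapping.single j 1" using T(2) by auto
      then show "Poly_Mapping.lookup (u w *\<^sub>R w) i = (if w = v then u w else 0)"
        using i by (cases "j = i")
          (auto simp: lookup_single when_def dest: arg_cong[where f=Poly_Mapping.keys])
    qed
    also have "\<dots> = u v" using T by simp
    finally show False using T(5) by simp
  qed
  then show ?thesis by (rule independent_mono) auto
qed

lemma dim_coord_space: "dim (coord_space n) = n"
proof -
  have "inj_on (\<lambda>i. Poly_Mapping.single i (1::real)) {..<n}"
    by (auto simp: inj_on_def dest: arg_cong[where f="\<lambda>x. Poly_Mapping.keys x"])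
  then have "dim (coord_space n) = card {..<n}"
    using independent_unit_vectors dim_eq_card_independent
    by (metis card_image coord_space_eq_span dim_span)
  then show ?thesis by simp
qed

text \<open>The empty set and, because \<open>a i \<le> b\<close>, all singletons are feasible;
  their lifts are \<open>e_n\<close> and \<open>e_i + e_n\<close>. This is full dimensionality of
  the polytope.\<close>

lemma dim_lifted_feasible:
  assumes "\<And>i. i < n \<Longrightarrow> a i \<le> b"
  shows "dim (lifted_char_vec n ` feasible_sets n a b) = Suc n"
proof -
  let ?L = "lifted_char_vec n ` feasible_sets n a b"
  have "?L \<subseteq> coord_space (Suc n)"
    using char_vec_in_coord_space
    by (fastforce simp: feasible_sets_def lifted_char_vec_def coord_space_iff lookup_lift)
  moreover have "Poly_Mapping.single i 1 \<in> span ?L" if "i < Suc n" for i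
  proof -
    have n: "Poly_Mapping.single n 1 \<in> span ?L"
      by (rule span_base, rule image_eqI[of _ _ "{}"])
        (auto simp: lifted_char_vec_def lift_def char_vec_def feasible_sets_def)
    have "lifted_char_vec n {i} \<in> span ?L" if "i < n"
      by (rule span_base) (use that assms in \<open>auto simp: feasible_sets_def\<close>)
    then have "Poly_Mapping.single i 1 \<in> span ?L" if "i < n"
      using n that span_diff[of "lifted_char_vec n {i}" ?L "Poly_Mapping.single n 1"]
      by (simp add: lifted_char_vec_def lift_def char_vec_def)
    then show ?thesis using n that less_Suc_eq by auto
  qed
  then have "coord_space (Suc n) \<subseteq> span ?L"
    unfolding coord_space_eq_span by (intro span_minimal) auto
  ultimately have "span ?L = coord_space (Suc n)"
    by (meson span_minimal subset_antisym subspace_coord_space)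
  then show ?thesis by (metis dim_coord_space dim_span)
qed

text \<open>Affine dimension \<open>n - 1\<close> of the face means that its lifted points span
  dimension \<open>n\<close>. Validity is what makes the face the hull of the feasible points on it,
  so the dimensions are compared only under validity.\<close>

lemma facet_defining_iff:
  assumes "\<And>i. i < n \<Longrightarrow> a i \<le> b"
  shows "facet_defining n \<alpha> \<beta> (knapsack_polytope n a b) \<longleftrightarrow>
    (\<forall>Y\<in>feasible_sets n a b. sum \<alpha> Y \<le> \<beta>) \<and>
    dim (lifted_char_vec n ` {Y \<in> feasible_sets n a b. sum \<alpha> Y = \<beta>}) = n"
proof -
  let ?F = "feasible_sets n a b"
  have lf: "lin_form n \<alpha> (char_vec Y) = real (sum \<alpha> Y)" if "Y \<in> ?F" for Y
    using that lin_form_char_vec by (simp add: feasible_sets_def)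
  have "valid_for n \<alpha> \<beta> (convex hull (char_vec ` ?F)) \<longleftrightarrow> (\<forall>Y\<in>?F. sum \<alpha> Y \<le> \<beta>)"
  proof
    assume "valid_for n \<alpha> \<beta> (convex hull (char_vec ` ?F))"
    then show "\<forall>Y\<in>?F. sum \<alpha> Y \<le> \<beta>"
      unfolding valid_for_def using lf
      by (metis hull_inc image_eqI of_nat_le_iff)
  next
    assume le: "\<forall>Y\<in>?F. sum \<alpha> Y \<le> \<beta>"
    have "convex {x. lin_form n \<alpha> x \<le> real \<beta>}"
      unfolding convex_def
      by (simp add: lin_form_combine convex_bound_le)
    then have "convex hull (char_vec ` ?F) \<subseteq> {x. lin_form n \<alpha> x \<le> real \<beta>}"
      by (intro hull_minimal) (use lf le in \<open>auto simp del: of_nat_sum\<close>)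
    then show "valid_for n \<alpha> \<beta> (convex hull (char_vec ` ?F))" by (auto simp: valid_for_def)
  qed
  moreover have "affine_dim (convex hull (char_vec ` ?F)) = int n"
    using affine_dim_hull_char_vec[of ?F n] dim_lifted_feasible[OF assms]
    by (simp add: feasible_sets_def)
  moreover have "affine_dim {x \<in> convex hull (char_vec ` ?F). lin_form n \<alpha> x = real \<beta>}
      = int (dim (lifted_char_vec n ` {Y \<in> ?F. sum \<alpha> Y = \<beta>})) - 1"
    if "\<forall>Y\<in>?F. sum \<alpha> Y \<le> \<beta>"
  proof -
    have "{x \<in> convex hull (char_vec ` ?F). lin_form n \<alpha> x = real \<beta>} =
      convex hull {x \<in> char_vec ` ?F. lin_form n \<alpha> x = real \<beta>}"
      by (rule hull_face_eq) (use that lf in \<open>auto simp del: of_nat_sum\<close>)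
    also have "{x \<in> char_vec ` ?F. lin_form n \<alpha> x = real \<beta>} = char_vec ` {Y \<in> ?F. sum \<alpha> Y = \<beta>}"
      using lf by (auto simp: image_iff simp del: of_nat_sum)
    finally show ?thesis
      using affine_dim_hull_char_vec[of "{Y \<in> ?F. sum \<alpha> Y = \<beta>}" n] by (simp add: feasible_sets_def)
  qed
  ultimately show ?thesis
    unfolding facet_defining_def knapsack_polytope_def knapsack_points_eq by auto
qed

section \<open>Canonical sets and exchanges\<close>

locale knapsack =
  fixes n :: nat and a \<alpha> :: "nat \<Rightarrow> nat"
begin

definition pos :: "nat set" where
  "pos = {i. i < n \<and> 0 < \<alpha> i}"

definition class_count :: "nat set \<Rightarrow> nat \<Rightarrow> nat" where
  "class_count X v = card {i \<in> X. \<alpha> i = v}"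

text \<open>Place values of the mixed radix system whose digits are the class counts.\<close>

definition weight :: "nat \<Rightarrow> nat" where
  "weight v = (\<Prod>u = 1..<v. class_count pos u + 1)"

text \<open>An item contributes the place value of its class, so the digit at a place is a class
  count. Cutting off at \<open>v\<close> yields the lower part of the numeral for inductions over
  the places.\<close>

definition code_below :: "nat set \<Rightarrow> nat \<Rightarrow> nat" where
  "code_below X v = (\<Sum>i | i \<in> X \<and> \<alpha> i < v. weight (\<alpha> i))"

definition code :: "nat set \<Rightarrow> nat" where
  "code X = (\<Sum>i\<in>X. weight (\<alpha> i))"

lemma finite_pos [simp]: "finite pos"
  by (simp add: pos_def)

lemma pos_subset: "pos \<subseteq> {..<n}"
  by (auto simp: pos_def)

lemma finite_subset_pos: "X \<subseteq> pos \<Longrightarrow> finite X"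
  using finite_subset finite_pos by blast

lemma weight_Suc: "1 \<le> v \<Longrightarrow> weight (Suc v) = weight v * (class_count pos v + 1)"
  by (simp add: weight_def)

lemma code_below_Suc:
  assumes "finite X"
  shows "code_below X (Suc v) = class_count X v * weight v + code_below X v"
proof -
  have "{i. i \<in> X \<and> \<alpha> i < Suc v} = {i \<in> X. \<alpha> i = v} \<union> {i. i \<in> X \<and> \<alpha> i < v}"
    by auto
  then have "code_below X (Suc v) = (\<Sum>i | i \<in> X \<and> \<alpha> i = v. weight (\<alpha> i)) + code_below X v"
    unfolding code_below_def using assms by (subst sum.union_disjoint[symmetric]) auto
  also have "(\<Sum>i | i \<in> X \<and> \<alpha> i = v. weight (\<alpha> i)) = class_count X v * weight v"
    by (simp add: class_count_def)
  finally show ?thesis .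
qed

text \<open>With all items chosen every digit is maximal, and adding one to such a numeral gives the
  next place value, as in 999 + 1 = 1000.\<close>

lemma code_below_pos: "code_below pos v + 1 = weight v"
proof (induction v)
  case 0
  show ?case by (simp add: code_below_def weight_def)
next
  case (Suc v)
  show ?case
  proof (cases "v = 0")
    case True
    \<comment> \<open>Items of \<open>pos\<close> have positive coefficient, so place 0 holds no
      digit and the weights start at place 1.\<close>
    have "{i. i \<in> pos \<and> \<alpha> i = 0} = {}" by (auto simp: pos_def)
    then show ?thesis using True by (simp add: code_below_def weight_def)
  next
    case False
    then show ?thesis using Suc by (simp add: code_below_Suc weight_Suc algebra_simps)
  qed
qed

lemma code_below_less:
  assumes "X \<subseteq> pos"
  shows "code_below X v < weight v"
proof -
  have "code_below X v \<le> code_below pos v"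
    unfolding code_below_def using assms by (intro sum_mono2) auto
  then show ?thesis using code_below_pos[of v] by linarith
qed

text \<open>Uniqueness of mixed radix digits: the lower part is less than the place value, so
  division yields the top digit, and the remainders agree one place lower.\<close>

lemma class_count_eqI_below:
  assumes "X \<subseteq> pos" "Y \<subseteq> pos" "code_below X V = code_below Y V" "v < V"
  shows "class_count X v = class_count Y v"
  using assms(3,4)
proof (induction V)
  case (Suc V)
  note less = code_below_less[OF assms(1), of V] code_below_less[OF assms(2), of V]
  have eq: "class_count X V * weight V + code_below X V = class_count Y V * weight V + code_below Y V"
    using Suc.prems assms(1,2) finite_subset_pos by (simp add: code_below_Suc)
  have "class_count X V = (class_count X V * weight V + code_below X V) div weight V"
    using less by simp
  also have "\<dots> = class_count Y V"
    unfolding eq using less by simp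
  finally have *: "class_count X V = class_count Y V" .
  then have "code_below X V = code_below Y V" using eq by simp
  then show ?case using Suc * less_antisym by blast
qed simp

text \<open>A strict bound on the coefficients; the sum in place of the maximum avoids a separate
  case for no items.\<close>

definition value_bound :: nat where
  "value_bound = Suc (\<Sum>i<n. \<alpha> i)"

lemma less_value_bound: "i < n \<Longrightarrow> \<alpha> i < value_bound"
  unfolding value_bound_def by (simp add: less_Suc_eq_le member_le_sum)

lemma code_eq_code_below:
  assumes "X \<subseteq> pos"
  shows "code X = code_below X value_bound"
proof -
  have "{i. i \<in> X \<and> \<alpha> i < value_bound} = X"
    using assms less_value_bound by (auto simp: pos_def)
  then show ?thesis by (simp add: code_def code_below_def)
qed

lemma class_count_eq_0:
  assumes "X \<subseteq> pos" "value_bound \<le> v"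
  shows "class_count X v = 0"
proof -
  have "{i \<in> X. \<alpha> i = v} = {}"
    using assms less_value_bound by (force simp: pos_def)
  then show ?thesis unfolding class_count_def by (simp only: card.empty)
qed

lemma class_count_eqI:
  assumes "X \<subseteq> pos" "Y \<subseteq> pos" "code X = code Y"
  shows "class_count X v = class_count Y v"
  using class_count_eqI_below[OF assms(1,2), of value_bound v] assms class_count_eq_0
  by (cases "v < value_bound") (auto simp: code_eq_code_below)

lemma code_mono: "X \<subseteq> pos \<Longrightarrow> code X \<le> code pos"
  unfolding code_def by (intro sum_mono2) auto

section \<open>The odometer step on canonical sets\<close>

definition is_next :: "nat set \<Rightarrow> nat \<Rightarrow> bool" where
  "is_next X m \<longleftrightarrow> m \<in> pos - X \<and> (\<forall>i\<in>pos - X. \<alpha> m < \<alpha> i \<or> \<alpha> m = \<alpha> i \<and> a m \<le> a i)"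

text \<open>When \<open>is_next X m\<close> holds, \<open>m\<close> is the lightest missing item of
  the lowest class that is not full. Raising that digit clears the lower ones, all of which are at
  their maximum: a carry.\<close>

definition successor :: "nat set \<Rightarrow> nat \<Rightarrow> nat set" where
  "successor X m = insert m X - {j. \<alpha> j < \<alpha> m}"

text \<open>The classes below \<open>\<alpha> m\<close> are full, so the items removed are worth one
  less than the place value of the item added.\<close>

lemma code_successor:
  assumes "X \<subseteq> pos" "is_next X m"
  shows "code (successor X m) = Suc (code X)"
proof -
  let ?L = "{j. j \<in> pos \<and> \<alpha> j < \<alpha> m}"
  have m: "m \<in> pos" "m \<notin> X" using assms by (auto simp: is_next_def)
  have L: "?L \<subseteq> X"
  proof
    fix j assume "j \<in> ?L"
    then show "j \<in> X"
      using assms(2) by (cases "j \<in> X") (auto simp: is_next_def dest!: bspec[where x=j])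
  qed
  have fin: "finite X" using assms(1) by (rule finite_subset_pos)
  have "successor X m = insert m (X - ?L)"
    using assms(1) m by (auto simp: successor_def)
  then have "code (successor X m) = weight (\<alpha> m) + code (X - ?L)"
    using fin m by (simp add: code_def)
  also have "weight (\<alpha> m) = Suc (code ?L)"
    using code_below_pos[of "\<alpha> m"] by (simp add: code_below_def code_def)
  also have "code X = code ?L + code (X - ?L)"
    unfolding code_def using sum.subset_diff[OF L fin] by (simp add: add.commute)
  ultimately show ?thesis by simp
qed

definition canonical :: "nat set \<Rightarrow> bool" where
  "canonical X \<longleftrightarrow> X \<subseteq> pos \<and> (\<forall>i\<in>X. \<forall>j\<in>pos - X. \<alpha> j = \<alpha> i \<longrightarrow> a i \<le> a j)"

lemma canonical_empty: "canonical {}"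
  by (simp add: canonical_def)

text \<open>Class by class: below \<open>\<alpha> m\<close> nothing is chosen any more, above it
  nothing changes, and the class of \<open>m\<close> gains the lightest of its missing
  items.\<close>

lemma canonical_successor:
  assumes "canonical X" "is_next X m"
  shows "canonical (successor X m)"
  unfolding canonical_def
proof (intro conjI ballI impI)
  show "successor X m \<subseteq> pos"
    using assms by (auto simp: canonical_def successor_def is_next_def)
  fix i j assume i: "i \<in> successor X m" and j: "j \<in> pos - successor X m" and eq: "\<alpha> j = \<alpha> i"
  then have "j \<in> pos - X" "i \<in> X \<or> i = m" by (auto simp: successor_def)
  moreover have "a i \<le> a j" if "i \<in> X"
    using assms(1) eq that \<open>j \<in> pos - X\<close> unfolding canonical_def by blast
  moreover have "a m \<le> a j" if "\<alpha> j = \<alpha> m"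
    using assms(2) that \<open>j \<in> pos - X\<close> unfolding is_next_def by (metis less_irrefl)
  ultimately show "a i \<le> a j" using eq by blast
qed

text \<open>
  Position \<open>n\<close> is not a coordinate, so choosing it flips nothing; for \<open>i = k\<close> the two flips cancel.
\<close>

definition flip_two :: "nat set \<Rightarrow> nat \<Rightarrow> nat \<Rightarrow> nat set" where
  "flip_two X i k = {j. j < n \<and> ((j \<in> X) \<noteq> ((j = i) \<noteq> (j = k)))}"

definition neighbours :: "nat set \<Rightarrow> nat set set" where
  "neighbours X = (\<Union>i<Suc n. flip_two X i ` {..<Suc n})"

lemma neighbours_subset: "Y \<in> neighbours X \<Longrightarrow> Y \<subseteq> {..<n}"
  by (auto simp: neighbours_def flip_two_def)

lemma flip_two_in_neighbours: "i \<le> n \<Longrightarrow> k \<le> n \<Longrightarrow> flip_two X i k \<in> neighbours X"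
  by (force simp: neighbours_def)

lemma self_in_neighbours:
  assumes "X \<subseteq> {..<n}"
  shows "X \<in> neighbours X"
proof -
  have "X = flip_two X n n" using assms by (auto simp: flip_two_def)
  then show ?thesis using flip_two_in_neighbours[of n n X] by simp
qed

section \<open>Decomposing a feasible set into moves from its canonical set\<close>

lemma lookup_lifted_char_vec:
  "Y \<subseteq> {..<n} \<Longrightarrow> Poly_Mapping.lookup (lifted_char_vec n Y) q = (if q \<in> Y \<or> q = n then 1 else 0)"
  using finite_subset[of Y "{..<n}"]
  by (auto simp: lifted_char_vec_def lookup_lift lookup_char_vec)

text \<open>Induction on the size of the symmetric difference. Undoing one move in \<open>Y\<close>
  gives a set \<open>Y'\<close> closer to \<open>X\<close>, and making the same move in
  \<open>X\<close> gives a neighbour \<open>Z\<close>; as 0/1 vectors \<open>Y + X = Y' + Z\<close>.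
  The move does not lower the weight, so \<open>Y'\<close> is feasible with \<open>Y\<close>. And
  \<open>Z\<close> exceeds \<open>X\<close> by exactly as much as \<open>Y\<close> exceeds
  \<open>Y'\<close>, so by induction \<open>Z\<close> is no heavier than \<open>Y\<close>.\<close>

lemma exchange:
  assumes X: "canonical X" and Y: "Y \<subseteq> {..<n}"
    and cnt: "\<And>v. 0 < v \<Longrightarrow> class_count Y v = class_count X v"
  shows "sum \<alpha> Y = sum \<alpha> X \<and> sum a X \<le> sum a Y \<and> (sum a Y \<le> b \<longrightarrow>
    lifted_char_vec n Y \<in> span (lifted_char_vec n ` {Z \<in> neighbours X. sum a Z \<le> b \<and> sum \<alpha> Z = sum \<alpha> X}))"
  (is "?P Y")
  using Y cnt
proof (induction "card ((X - Y) \<union> (Y - X))" arbitrary: Y rule: less_induct)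
  case less
  let ?S = "span (lifted_char_vec n ` {Z \<in> neighbours X. sum a Z \<le> b \<and> sum \<alpha> Z = sum \<alpha> X})"
  have Xn: "X \<subseteq> {..<n}" and Xp: "X \<subseteq> pos" using X pos_subset by (auto simp: canonical_def)
  have fin: "finite X" "finite Y" using Xn less.prems(1) finite_subset by blast+
  have base: "lifted_char_vec n Z \<in> ?S" if "Z \<in> neighbours X" "sum a Z \<le> b" "sum \<alpha> Z = sum \<alpha> X" for Z
    using that by (intro span_base) auto
  \<comment> \<open>Equal unions and intersections make the sums of 0/1 vectors equal, and the
    lifting coordinate is 1 in all four, so the relation passes to the lifts.\<close>
  have comb: "lifted_char_vec n Y \<in> ?S"
    if "Y' \<subseteq> {..<n}" "Z \<subseteq> {..<n}" "lifted_char_vec n Y' \<in> ?S" "lifted_char_vec n Z \<in> ?S"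
      "lifted_char_vec n X \<in> ?S"
      "Y \<union> X = Y' \<union> Z" "Y \<inter> X = Y' \<inter> Z"
    for Y' Z
  proof -
    have "lifted_char_vec n Y + lifted_char_vec n X = lifted_char_vec n Y' + lifted_char_vec n Z"
    proof (rule poly_mapping_eqI)
      fix q
      show "Poly_Mapping.lookup (lifted_char_vec n Y + lifted_char_vec n X) q =
        Poly_Mapping.lookup (lifted_char_vec n Y' + lifted_char_vec n Z) q"
        using that(6,7)[THEN eqset_imp_iff, of q]
        unfolding lookup_add lookup_lifted_char_vec[OF that(1)] lookup_lifted_char_vec[OF that(2)]
          lookup_lifted_char_vec[OF Xn] lookup_lifted_char_vec[OF less.prems(1)] by auto
    qed
    then have "lifted_char_vec n Y = lifted_char_vec n Y' + lifted_char_vec n Z - lifted_char_vec n X"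
      by (simp add: eq_diff_eq)
    then show ?thesis using that by (simp add: span_add span_diff)
  qed
  \<comment> \<open>An item with coefficient 0 is never in \<open>X\<close> and can be removed.
    Otherwise, unless \<open>Y = X\<close>, the two sets differ inside a class where they have
    equally many items; neither contains the other there, so an exchange is available.\<close>
  consider "Y = X" | i where "i \<in> Y" "\<alpha> i = 0"
    | i j where "i \<in> X" "i \<notin> Y" "j \<in> Y" "j \<notin> X" "\<alpha> i = \<alpha> j"
  proof (cases "Y = X \<or> (\<exists>i\<in>Y. \<alpha> i = 0)")
    case False
    then obtain k where k: "k \<in> (X - Y) \<union> (Y - X)" by auto
    define v where "v = \<alpha> k"
    have v: "0 < v" using k False Xp by (auto simp: v_def pos_def)
    let ?Xv = "{i \<in> X. \<alpha> i = v}" and ?Yv = "{i \<in> Y. \<alpha> i = v}"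
    have card: "card ?Yv = card ?Xv"
      using less.prems(2)[OF v] by (simp add: class_count_def)
    have ne: "?Xv \<noteq> ?Yv" using k by (auto simp: v_def)
    have "\<not> ?Xv \<subseteq> ?Yv" "\<not> ?Yv \<subseteq> ?Xv"
      using card ne fin card_subset_eq[of ?Yv ?Xv] card_subset_eq[of ?Xv ?Yv] by auto
    then show thesis using that(3) by fastforce
  qed (use that in auto)
  then show ?case
  proof cases
    case 1
    then show ?thesis using base[OF self_in_neighbours[OF Xn]] by simp
  next
    case (2 i)
    let ?Y = "Y - {i}" and ?Z = "insert i X"
    have iX: "i \<notin> X" "i < n" using 2 Xp less.prems(1) by (auto simp: pos_def)
    have "(X - ?Y) \<union> (?Y - X) \<subset> (X - Y) \<union> (Y - X)" using 2 iX by auto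
    then have "card ((X - ?Y) \<union> (?Y - X)) < card ((X - Y) \<union> (Y - X))"
      using fin by (intro psubset_card_mono) auto
    moreover have "class_count ?Y v = class_count X v" if "0 < v" for v
    proof -
      have "{j \<in> ?Y. \<alpha> j = v} = {j \<in> Y. \<alpha> j = v}" using 2 that by auto
      then show ?thesis using less.prems(2)[OF that] by (simp add: class_count_def)
    qed
    ultimately have IH: "?P ?Y" using less.prems(1) by (intro less.hyps) auto
    have s: "sum \<alpha> Y = sum \<alpha> ?Y" "sum a Y = a i + sum a ?Y"
      using 2 fin by (auto simp: sum.remove)
    have Z: "?Z = flip_two X i n" using iX Xn by (auto simp: flip_two_def)
    have "lifted_char_vec n Y \<in> ?S" if le: "sum a Y \<le> b"
    proof (rule comb[of ?Y ?Z])
      show "lifted_char_vec n ?Z \<in> ?S"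
      proof (rule base)
        show "?Z \<in> neighbours X" unfolding Z using iX by (intro flip_two_in_neighbours) auto
        have "sum a ?Z = a i + sum a X" "sum \<alpha> ?Z = sum \<alpha> X" using iX fin 2 by simp_all
        then show "sum a ?Z \<le> b" "sum \<alpha> ?Z = sum \<alpha> X" using IH le s by linarith+
      qed
      have "sum a ?Y \<le> b" using s le by linarith
      then show "lifted_char_vec n ?Y \<in> ?S" using IH by blast
      show "lifted_char_vec n X \<in> ?S"
        using IH s le by (intro base self_in_neighbours Xn refl) linarith
      show "?Y \<subseteq> {..<n}" "?Z \<subseteq> {..<n}" using less.prems(1) Xn iX(2) by auto
      show "Y \<union> X = ?Y \<union> ?Z" "Y \<inter> X = ?Y \<inter> ?Z" using 2(1) iX(1) by blast+
    qed
    moreover have "sum \<alpha> Y = sum \<alpha> X" "sum a X \<le> sum a Y" using IH s by linarith+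
    ultimately show ?thesis by blast
  next
    case (3 i j)
    let ?Y = "insert i (Y - {j})" and ?Z = "insert j (X - {i})"
    have ij: "i < n" "j < n" "i \<noteq> j" using 3 Xp less.prems(1) by (auto simp: pos_def)
    have "0 < \<alpha> i" using 3 Xp by (auto simp: pos_def)
    \<comment> \<open>Canonicity gives the direction of the exchange: \<open>i\<close> is chosen in
      \<open>X\<close> and \<open>j\<close> is not, within one class of positive
      coefficient.\<close>
    then have aij: "a i \<le> a j" using X 3 ij by (auto simp: canonical_def pos_def)
    have "(X - ?Y) \<union> (?Y - X) \<subset> (X - Y) \<union> (Y - X)" using 3 by auto
    then have "card ((X - ?Y) \<union> (?Y - X)) < card ((X - Y) \<union> (Y - X))"
      using fin by (intro psubset_card_mono) auto
    moreover have "class_count ?Y v = class_count X v" if "0 < v" for v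
    proof (cases "v = \<alpha> i")
      case True
      have "{k \<in> ?Y. \<alpha> k = v} = insert i ({k \<in> Y. \<alpha> k = v} - {j})" using 3 True by auto
      then have "class_count ?Y v = Suc (card ({k \<in> Y. \<alpha> k = v} - {j}))"
        using fin 3 by (simp add: class_count_def)
      also have "\<dots> = card {k \<in> Y. \<alpha> k = v}"
        using fin 3 True by (intro card_Suc_Diff1) auto
      finally show ?thesis using less.prems(2)[OF that] by (simp add: class_count_def)
    next
      case False
      then have "{k \<in> ?Y. \<alpha> k = v} = {k \<in> Y. \<alpha> k = v}" using 3 by auto
      then show ?thesis using less.prems(2)[OF that] by (simp add: class_count_def)
    qed
    ultimately have IH: "?P ?Y" using less.prems(1) ij by (intro less.hyps) auto
    have sY: "sum f Y = f j + sum f (Y - {j})" "sum f ?Y = f i + sum f (Y - {j})" for f :: "nat \<Rightarrow> nat"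
      using 3 fin by (auto simp: sum.remove)
    have sX: "sum f X = f i + sum f (X - {i})" "sum f ?Z = f j + sum f (X - {i})" for f :: "nat \<Rightarrow> nat"
      using 3 fin by (auto simp: sum.remove)
    have Z: "?Z = flip_two X i j" using ij Xn 3 by (auto simp: flip_two_def)
    have "lifted_char_vec n Y \<in> ?S" if le: "sum a Y \<le> b"
    proof (rule comb[of ?Y ?Z])
      show "lifted_char_vec n ?Z \<in> ?S"
      proof (rule base)
        show "?Z \<in> neighbours X" unfolding Z using ij by (intro flip_two_in_neighbours) auto
        \<comment> \<open>\<open>X\<close> is no heavier than \<open>?Y\<close>, and
          \<open>?Z\<close> and \<open>Y\<close> arise from these two by the same replacement of
          \<open>i\<close> by \<open>j\<close>.\<close>
        show "sum a ?Z \<le> b" using IH le sX[of a] sY[of a] by linarith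
        show "sum \<alpha> ?Z = sum \<alpha> X" using sX[of \<alpha>] 3 by linarith
      qed
      show "lifted_char_vec n X \<in> ?S"
        using IH sY[of a] aij le by (intro base self_in_neighbours Xn refl) linarith
      have "sum a ?Y \<le> b" using sY[of a] aij le by linarith
      then show "lifted_char_vec n ?Y \<in> ?S" using IH by blast
      show "?Y \<subseteq> {..<n}" "?Z \<subseteq> {..<n}" using less.prems(1) Xn ij by auto
      show "Y \<union> X = ?Y \<union> ?Z" "Y \<inter> X = ?Y \<inter> ?Z" using 3(1-4) by blast+
    qed
    moreover have "sum \<alpha> Y = sum \<alpha> X" "sum a X \<le> sum a Y"
      using IH sY[of a] sY[of \<alpha>] aij 3 by linarith+
    ultimately show ?thesis by blast
  qed
qed

section \<open>Families of canonical sets that represent all class counts\<close>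

definition covering :: "nat set set \<Rightarrow> bool" where
  "covering V \<longleftrightarrow> (\<forall>X\<in>V. canonical X) \<and>
    (\<forall>Y\<subseteq>pos. \<exists>X\<in>V. \<forall>v. class_count Y v = class_count X v)"

text \<open>Items with coefficient 0 do not enter the counts of positive classes, so
  \<open>Y\<close> may be cut down to \<open>pos\<close> before a representative is taken.\<close>

lemma covering_obtain:
  assumes "covering V" "Y \<subseteq> {..<n}"
  obtains X where "X \<in> V" "canonical X" "\<And>v. 0 < v \<Longrightarrow> class_count Y v = class_count X v"
proof -
  have "Y \<inter> pos \<subseteq> pos" by simp
  then obtain X where X: "X \<in> V" "canonical X" "\<forall>v. class_count (Y \<inter> pos) v = class_count X v"
    using assms(1) unfolding covering_def by blast
  have "class_count (Y \<inter> pos) v = class_count Y v" if "0 < v" for v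
  proof -
    have "{i \<in> Y \<inter> pos. \<alpha> i = v} = {i \<in> Y. \<alpha> i = v}" using that assms(2) by (auto simp: pos_def)
    then show ?thesis by (simp add: class_count_def)
  qed
  then show ?thesis using that X by metis
qed

text \<open>The representative with the same counts has the same value and is no heavier, so it
  violates the inequality whenever the feasible set does; and it is its own neighbour.\<close>

lemma covering_valid:
  assumes "covering V"
  shows "(\<forall>Y\<in>feasible_sets n a b. sum \<alpha> Y \<le> \<beta>) \<longleftrightarrow>
    (\<forall>Y\<in>\<Union>(neighbours ` V). sum a Y \<le> b \<longrightarrow> sum \<alpha> Y \<le> \<beta>)"
proof
  assume "\<forall>Y\<in>feasible_sets n a b. sum \<alpha> Y \<le> \<beta>"
  then show "\<forall>Y\<in>\<Union>(neighbours ` V). sum a Y \<le> b \<longrightarrow> sum \<alpha> Y \<le> \<beta>"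
    using neighbours_subset by (force simp: feasible_sets_def)
next
  assume *: "\<forall>Y\<in>\<Union>(neighbours ` V). sum a Y \<le> b \<longrightarrow> sum \<alpha> Y \<le> \<beta>"
  show "\<forall>Y\<in>feasible_sets n a b. sum \<alpha> Y \<le> \<beta>"
  proof
    fix Y assume "Y \<in> feasible_sets n a b"
    then have Y: "Y \<subseteq> {..<n}" "sum a Y \<le> b" by (auto simp: feasible_sets_def)
    from covering_obtain[OF assms Y(1)] obtain X where X: "X \<in> V" "canonical X"
      "\<And>v. 0 < v \<Longrightarrow> class_count Y v = class_count X v" by metis
    have "X \<in> neighbours X"
      using X(2) pos_subset by (intro self_in_neighbours) (auto simp: canonical_def)
    then show "sum \<alpha> Y \<le> \<beta>"
      using exchange[OF X(2) Y(1) X(3)] * X(1) Y(2) by fastforce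
  qed
qed

text \<open>For \<open>Y\<close> on the face the representative \<open>X\<close> has value
  \<open>\<beta>\<close> too, so the neighbours that span the lift of \<open>Y\<close> all belong to
  the face.\<close>

lemma covering_span:
  assumes "covering V"
  shows "span (lifted_char_vec n ` {Y \<in> feasible_sets n a b. sum \<alpha> Y = \<beta>}) =
    span (lifted_char_vec n ` {Y \<in> \<Union>(neighbours ` V). sum a Y \<le> b \<and> sum \<alpha> Y = \<beta>})"
    (is "span ?F = span ?G")
proof (rule subset_antisym)
  show "span ?G \<subseteq> span ?F"
    using neighbours_subset by (intro span_mono) (force simp: feasible_sets_def)
  have "lifted_char_vec n Y \<in> span ?G" if Y: "Y \<subseteq> {..<n}" "sum a Y \<le> b" "sum \<alpha> Y = \<beta>" for Y
  proof -
    from covering_obtain[OF assms Y(1)] obtain X where X: "X \<in> V" "canonical X"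
      "\<And>v. 0 < v \<Longrightarrow> class_count Y v = class_count X v" by metis
    note ex = exchange[OF X(2) Y(1) X(3), of b]
    have "span (lifted_char_vec n ` {Z \<in> neighbours X. sum a Z \<le> b \<and> sum \<alpha> Z = sum \<alpha> X}) \<subseteq> span ?G"
      using X(1) ex Y(3) by (intro span_mono) auto
    then show ?thesis using ex Y by auto
  qed
  then show "span ?F \<subseteq> span ?G"
    by (intro span_minimal subspace_span) (auto simp: feasible_sets_def)
qed

text \<open>\<open>code pos\<close> has all digits maximal, so its successor is the product of
  \<open>k + 1\<close> over the sizes \<open>k\<close> of the classes. With two or more classes each
  one misses an item, so \<open>k + 1 \<le> n\<close>; only a lone class can reach
  \<open>n + 1 \<le> 2 * n\<close>, which costs the factor 2 once.\<close>

lemma Suc_code_pos_le: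
  assumes "1 \<le> n"
  shows "Suc (code pos) \<le> 2 * n ^ num_pos_values n \<alpha>"
proof -
  let ?V = "{\<alpha> i | i. i < n \<and> \<alpha> i > 0}"
  have V: "?V = \<alpha> ` pos" by (auto simp: pos_def)
  have "?V \<subseteq> {1..<value_bound}" using less_value_bound by fastforce
  moreover have "class_count pos u = 0" if "u \<notin> ?V" for u
    using that unfolding V class_count_def by (auto simp: card_eq_0_iff)
  \<comment> \<open>Places without items contribute the factor 1, so only the values that occur
    remain.\<close>
  ultimately have "weight value_bound = (\<Prod>u\<in>?V. class_count pos u + 1)"
    unfolding weight_def by (intro prod.mono_neutral_right) auto
  moreover have "Suc (code pos) = weight value_bound"
    using code_below_pos[of value_bound] code_eq_code_below[of pos] by simp
  moreover have "(\<Prod>u\<in>?V. class_count pos u + 1) \<le> 2 * n ^ card ?V"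
  proof -
    have le: "class_count pos u \<le> n" for u
      using card_mono[of "{..<n}" "{i \<in> pos. \<alpha> i = u}"] pos_subset by (auto simp: class_count_def)
    have less: "class_count pos u < n" if "v \<in> ?V" "u \<noteq> v" for u v
    proof -
      from that obtain i where "i < n" "\<alpha> i = v" by auto
      then have "{i \<in> pos. \<alpha> i = u} \<subset> {..<n}" using that pos_subset by auto
      then have "card {i \<in> pos. \<alpha> i = u} < card {..<n}" by (intro psubset_card_mono) auto
      then show ?thesis by (simp add: class_count_def)
    qed
    consider "?V = {}" | v where "?V = {v}" "class_count pos v \<le> n"
      | "\<forall>u\<in>?V. class_count pos u < n"
    proof (cases "?V = {} \<or> (\<exists>v. ?V = {v})")
      case False
      have "class_count pos u < n" if "u \<in> ?V" for u
      proof -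
        have "\<not> ?V \<subseteq> {u}" using False by (simp only: subset_singleton_iff) blast
        then obtain v where "v \<in> ?V" "u \<noteq> v" by blast
        then show ?thesis using less by blast
      qed
      then show thesis using that(3) by blast
    qed (use le that(1,2) in blast)
    then show ?thesis
    proof cases
      case 1
      show ?thesis unfolding 1 by simp
    next
      case (2 v)
      show ?thesis unfolding 2(1) using 2(2) assms by simp
    next
      case 3
      then have "(\<Prod>u\<in>?V. class_count pos u + 1) \<le> (\<Prod>u\<in>?V. n)"
        by (intro prod_mono) (simp add: Suc_le_eq)
      also have "\<dots> = n ^ card ?V" by (simp only: prod_constant)
      finally show ?thesis by linarith
    qed
  qed
  ultimately show ?thesis by (simp add: num_pos_values_def)
qed

end

section \<open>Integer row echelon matrices\<close>

definition int_vec :: "nat \<Rightarrow> (nat \<Rightarrow> int) \<Rightarrow> point" where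
  "int_vec N f = (\<Sum>q<N. of_int (f q) *\<^sub>R Poly_Mapping.single q 1)"

lemma lookup_int_vec: "Poly_Mapping.lookup (int_vec N f) q = (if q < N then of_int (f q) else 0)"
  by (simp add: int_vec_def lookup_sum_single)

lemma int_vec_cong: "(\<And>q. q < N \<Longrightarrow> f q = g q) \<Longrightarrow> int_vec N f = int_vec N g"
  by (simp add: int_vec_def)

lemma int_vec_0: "int_vec N (\<lambda>_. 0) = 0"
  by (simp add: int_vec_def)

lemma int_vec_combine:
  "int_vec N (\<lambda>q. c * f q - d * g q) = of_int c *\<^sub>R int_vec N f - of_int d *\<^sub>R int_vec N g"
  by (rule poly_mapping_eqI) (simp add: lookup_int_vec lookup_minus)

text \<open>Row \<open>p\<close> is reserved for the pivot in column \<open>p\<close> and is zero as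
  long as there is none. So rows are never swapped, and the zero matrix is a legitimate
  start.\<close>

definition echelon :: "nat \<Rightarrow> (nat \<Rightarrow> nat \<Rightarrow> int) \<Rightarrow> nat \<Rightarrow> bool" where
  "echelon N M r \<longleftrightarrow> (\<forall>p<N. \<forall>q<p. M p q = 0) \<and>
     (\<forall>p<N. M p p = 0 \<longrightarrow> (\<forall>q<N. M p q = 0)) \<and> r = card {p. p < N \<and> M p p \<noteq> 0}"

text \<open>The quantity that elimination keeps constant: \<open>y\<close> is the vector still being
  reduced.\<close>

definition row_span :: "nat \<Rightarrow> (nat \<Rightarrow> nat \<Rightarrow> int) \<Rightarrow> (nat \<Rightarrow> int) \<Rightarrow> point set" where
  "row_span N M y = span (insert (int_vec N y) ((\<lambda>p. int_vec N (M p)) ` {..<N}))"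

lemma echelon_cong:
  "(\<And>p q. p < N \<Longrightarrow> q < N \<Longrightarrow> M p q = M' p q) \<Longrightarrow> echelon N M r \<longleftrightarrow> echelon N M' r"
proof -
  assume *: "\<And>p q. p < N \<Longrightarrow> q < N \<Longrightarrow> M p q = M' p q"
  have "{p. p < N \<and> M p p \<noteq> 0} = {p. p < N \<and> M' p p \<noteq> 0}" using * by auto
  moreover have "(\<forall>p<N. \<forall>q<p. M p q = 0) \<longleftrightarrow> (\<forall>p<N. \<forall>q<p. M' p q = 0)"
    by (intro all_cong) (simp add: *)
  moreover have "(\<forall>p<N. M p p = 0 \<longrightarrow> (\<forall>q<N. M p q = 0)) \<longleftrightarrow> (\<forall>p<N. M' p p = 0 \<longrightarrow> (\<forall>q<N. M' p q = 0))"
    using * by simp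
  ultimately show ?thesis unfolding echelon_def by simp
qed

lemma row_span_cong:
  assumes "\<And>p q. p < N \<Longrightarrow> q < N \<Longrightarrow> M p q = M' p q" "\<And>q. q < N \<Longrightarrow> y q = y' q"
  shows "row_span N M y = row_span N M' y'"
proof -
  have "(\<lambda>p. int_vec N (M p)) ` {..<N} = (\<lambda>p. int_vec N (M' p)) ` {..<N}"
    using assms(1) by (intro image_cong int_vec_cong) auto
  moreover have "int_vec N y = int_vec N y'" using assms(2) by (rule int_vec_cong)
  ultimately show ?thesis by (simp add: row_span_def)
qed

lemma row_span_zero: "(\<And>q. q < N \<Longrightarrow> y q = 0) \<Longrightarrow> row_span N M y = span ((\<lambda>p. int_vec N (M p)) ` {..<N})"
  using int_vec_cong[of N y "\<lambda>_. 0"] by (simp add: row_span_def int_vec_0 span_insert_0)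

text \<open>Row \<open>p\<close> was zero, so overwriting it loses nothing; since \<open>y\<close>
  vanishes before \<open>p\<close>, its pivot lands on the diagonal.\<close>

lemma echelon_store:
  assumes "echelon N M r" "p < N" "M p p = 0" "y p \<noteq> 0" "\<And>q. q < p \<Longrightarrow> y q = 0"
  shows "echelon N (M(p := y)) (Suc r)"
    and "row_span N (M(p := y)) (\<lambda>_. 0) = row_span N M y"
proof -
  let ?M = "M(p := y)"
  have "{p'. p' < N \<and> ?M p' p' \<noteq> 0} = insert p {p'. p' < N \<and> M p' p' \<noteq> 0}"
    using assms by auto
  then have "card {p'. p' < N \<and> ?M p' p' \<noteq> 0} = Suc (card {p'. p' < N \<and> M p' p' \<noteq> 0})"
    using assms by simp
  then show "echelon N ?M (Suc r)"
    using assms unfolding echelon_def by simp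
  have z: "int_vec N (M p) = 0"
    using assms int_vec_cong[of N "M p" "\<lambda>_. 0"] by (simp add: echelon_def int_vec_0)
  let ?R = "(\<lambda>p. int_vec N (M p)) ` ({..<N} - {p})"
  have "{..<N} = insert p ({..<N} - {p})" using assms by auto
  then have 1: "f ` {..<N} = insert (f p) (f ` ({..<N} - {p}))" for f :: "nat \<Rightarrow> point" by blast
  have "(\<lambda>p. int_vec N (?M p)) ` ({..<N} - {p}) = ?R" by (intro image_cong) auto
  then have 2: "(\<lambda>p. int_vec N (?M p)) ` {..<N} = insert (int_vec N y) ?R"
    unfolding 1[of "\<lambda>p. int_vec N (?M p)"] by simp
  have "row_span N M y = span (insert 0 (insert (int_vec N y) ?R))"
    unfolding row_span_def 1[of "\<lambda>p. int_vec N (M p)"] z by (simp only: insert_commute)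
  also have "\<dots> = row_span N ?M (\<lambda>_. 0)"
    unfolding row_span_def 2 int_vec_0 ..
  finally show "row_span N ?M (\<lambda>_. 0) = row_span N M y" ..
qed

text \<open>Cross multiplication replaces division: \<open>y\<close> is scaled by the nonzero pivot,
  which over the reals can be undone.\<close>

lemma row_span_reduce:
  assumes "p < N" "M p p \<noteq> 0"
  shows "row_span N M (\<lambda>q. M p p * y q - y p * M p q) = row_span N M y"
proof -
  let ?R = "(\<lambda>p. int_vec N (M p)) ` {..<N}"
  let ?z = "int_vec N (\<lambda>q. M p p * y q - y p * M p q)"
  have z: "?z = of_int (M p p) *\<^sub>R int_vec N y - of_int (y p) *\<^sub>R int_vec N (M p)"
    by (rule int_vec_combine)
  have R: "int_vec N (M p) \<in> ?R" using assms by auto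
  have y: "int_vec N y = (1 / of_int (M p p)) *\<^sub>R (?z + of_int (y p) *\<^sub>R int_vec N (M p))"
    using assms by (simp add: z)
  have "?z \<in> span (insert (int_vec N y) ?R)"
    unfolding z using R by (intro span_diff span_scale) (auto intro: span_base)
  moreover have "int_vec N y \<in> span (insert ?z ?R)"
    by (subst y, intro span_scale span_add) (use R in \<open>auto intro: span_base\<close>)
  moreover have "?R \<subseteq> span (insert w ?R)" for w by (auto intro: span_base)
  ultimately show ?thesis
    unfolding row_span_def by (intro subset_antisym span_minimal subspace_span) auto
qed

text \<open>The nonzero rows are independent: added from the last one upwards, row \<open>k\<close>
  is nonzero in column \<open>k\<close>, where all later rows vanish.\<close>

lemma echelon_dim:
  assumes "echelon N M r"
  shows "dim (span ((\<lambda>p. int_vec N (M p)) ` {..<N})) = r"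
proof -
  let ?v = "\<lambda>p. int_vec N (M p)"
  let ?A = "\<lambda>k. {p. k \<le> p \<and> p < N \<and> M p p \<noteq> 0}"
  have "independent (?v ` ?A k) \<and> card (?v ` ?A k) = card (?A k)" if "k \<le> N" for k
    using that
  proof (induction k rule: inc_induct)
    case base
    have "?A N = {}" by auto
    then show ?case by (simp only: image_empty card.empty independent_empty simp_thms)
  next
    case (step k)
    have split: "k \<le> p \<longleftrightarrow> p = k \<or> Suc k \<le> p" for p by arith
    show ?case
    proof (cases "M k k = 0")
      case True
      then have "?A k = ?A (Suc k)" unfolding split by blast
      then show ?thesis using step.IH by simp
    next
      case False
      then have A: "?A k = insert k (?A (Suc k))" using step.hyps unfolding split by blast
      have "subspace {x :: point. Poly_Mapping.lookup x k = 0}"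
        by (auto simp: subspace_def lookup_add)
      moreover have "?v ` ?A (Suc k) \<subseteq> {x. Poly_Mapping.lookup x k = 0}"
        using assms by (auto simp: lookup_int_vec echelon_def)
      ultimately have "span (?v ` ?A (Suc k)) \<subseteq> {x. Poly_Mapping.lookup x k = 0}"
        by (rule span_minimal[rotated])
      moreover have "Poly_Mapping.lookup (?v k) k \<noteq> 0"
        using False step.hyps by (simp add: lookup_int_vec)
      ultimately have notin: "?v k \<notin> span (?v ` ?A (Suc k))" by blast
      have fin: "finite (?A (Suc k))" by simp
      have "?v k \<notin> ?v ` ?A (Suc k)" using notin by (rule contrapos_nn) (rule span_base)
      then have "card (?v ` ?A k) = Suc (card (?v ` ?A (Suc k)))"
        unfolding A image_insert by (intro card_insert_disjoint finite_imageI fin)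
      moreover have "card (?A k) = Suc (card (?A (Suc k)))"
        unfolding A by (intro card_insert_disjoint fin) simp
      moreover have "independent (?v ` ?A k)"
        unfolding A image_insert by (rule independent_insertI[OF notin]) (rule step.IH[THEN conjunct1])
      moreover have "card (?v ` ?A (Suc k)) = card (?A (Suc k))" by (rule step.IH[THEN conjunct2])
      ultimately show ?thesis by linarith
    qed
  qed
  from this[of 0] have ind: "independent (?v ` ?A 0)" "card (?v ` ?A 0) = r"
    using assms by (auto simp: echelon_def)
  have sup: "?v ` {..<N} \<subseteq> span (?v ` ?A 0)"
  proof (rule image_subsetI)
    fix p assume p: "p \<in> {..<N}"
    show "?v p \<in> span (?v ` ?A 0)"
    proof (cases "M p p = 0")
      case True
      then have "?v p = 0"
        using p assms int_vec_cong[of N "M p" "\<lambda>_. 0"] by (simp add: echelon_def int_vec_0)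
      then show ?thesis by (simp add: span_zero)
    next
      case False
      then show ?thesis using p by (intro span_base) auto
    qed
  qed
  have sub: "?v ` ?A 0 \<subseteq> ?v ` {..<N}" by (intro image_mono) auto
  have "span (?v ` ?A 0) = span (?v ` {..<N})"
    by (rule subset_antisym[OF span_mono[OF sub] span_minimal[OF sup subspace_span]])
  then have "dim (span (?v ` {..<N})) = dim (?v ` ?A 0)" using dim_span[of "?v ` ?A 0"] by simp
  also have "\<dots> = r" using ind dim_eq_card_independent[OF ind(1)] by simp
  finally show ?thesis .
qed

section \<open>Time-bounded execution\<close>

text \<open>Total correctness with an upper bound on time; exact costs would depend on the branches
  taken.\<close>

definition runs :: "com \<Rightarrow> state \<Rightarrow> nat \<Rightarrow> (state \<Rightarrow> bool) \<Rightarrow> bool" where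
  "runs p s T Q \<longleftrightarrow> (\<exists>t s'. exec p s t s' \<and> t \<le> T \<and> Q s')"

fun writes :: "com \<Rightarrow> string set" where
  "writes Skip = {}"
| "writes (Assign x i e) = {x}"
| "writes (Seq p q) = writes p \<union> writes q"
| "writes (Cond g p q) = writes p \<union> writes q"
| "writes (While g p) = writes p"

lemma exec_frame: "exec p s t s' \<Longrightarrow> v \<notin> writes p \<Longrightarrow> s' v = s v"
  by (induction rule: exec.induct) auto

lemma runs_frame: "runs p s T Q \<Longrightarrow> runs p s T (\<lambda>s'. Q s' \<and> (\<forall>v. v \<notin> writes p \<longrightarrow> s' v = s v))"
  unfolding runs_def using exec_frame by blast

lemma runs_mono:
  "runs p s T Q \<Longrightarrow> T \<le> T' \<Longrightarrow> (\<And>s'. Q s' \<Longrightarrow> Q' s') \<Longrightarrow> runs p s T' Q'"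
  unfolding runs_def by (meson le_trans)

text \<open>This and the following simplification rules are equivalences, so straight-line code is
  executed symbolically by rewriting. Each instruction subtracts its cost from the budget; the guard
  \<open>\<le> T\<close> rules out that the subtraction is truncated.\<close>

lemma runs_Skip [simp]: "runs Skip s T Q \<longleftrightarrow> 1 \<le> T \<and> Q s"
  unfolding runs_def by (auto elim: exec_SkipE intro: exec.Skip[simplified])

lemma runs_Assign [simp]: "runs (Assign x i e) s T Q \<longleftrightarrow>
    acost i + acost e + 1 \<le> T \<and> Q (s(x := (s x)(aval s i := aval s e)))"
  unfolding runs_def by (auto elim: exec_AssignE intro: exec.Assign[simplified])

lemma runs_SeqI:
  assumes "runs p s T Q" "\<And>s'. Q s' \<Longrightarrow> runs q s' U R" "T + U \<le> V"
  shows "runs (Seq p q) s V R"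
proof -
  obtain t s' where 1: "exec p s t s'" "t \<le> T" "Q s'" using assms(1) by (auto simp: runs_def)
  obtain u s'' where 2: "exec q s' u s''" "u \<le> U" "R s''"
    using assms(2)[OF 1(3)] by (auto simp: runs_def)
  show ?thesis unfolding runs_def
    using exec.Seq[OF 1(1) 2(1)] 1(2) 2(2,3) assms(3) by (meson add_mono le_trans)
qed

lemma runs_Seq_Skip [simp]: "runs (Seq Skip q) s T Q \<longleftrightarrow> 1 \<le> T \<and> runs q s (T - 1) Q"
proof
  assume "1 \<le> T \<and> runs q s (T - 1) Q"
  then show "runs (Seq Skip q) s T Q"
    by (intro runs_SeqI[where T=1 and U="T - 1" and Q="\<lambda>s'. s' = s"]) auto
next
  assume "runs (Seq Skip q) s T Q"
  then obtain u s' where "1 + u \<le> T" "Q s'" "exec q s u s'"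
    by (auto simp: runs_def elim!: exec_SeqE exec_SkipE)
  then show "1 \<le> T \<and> runs q s (T - 1) Q"
    unfolding runs_def by (intro conjI exI[of _ u] exI[of _ s']) auto
qed

lemma runs_Seq_Assign [simp]: "runs (Seq (Assign x i e) q) s T Q \<longleftrightarrow>
    acost i + acost e + 1 \<le> T \<and>
    runs q (s(x := (s x)(aval s i := aval s e))) (T - (acost i + acost e + 1)) Q"
proof
  assume "acost i + acost e + 1 \<le> T \<and>
    runs q (s(x := (s x)(aval s i := aval s e))) (T - (acost i + acost e + 1)) Q"
  then show "runs (Seq (Assign x i e) q) s T Q"
    by (intro runs_SeqI[where T="acost i + acost e + 1" and U="T - (acost i + acost e + 1)"
          and Q="\<lambda>s'. s' = s(x := (s x)(aval s i := aval s e))"]) auto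
next
  assume "runs (Seq (Assign x i e) q) s T Q"
  then obtain t s' u where "acost i + acost e + 1 + u \<le> T" "Q s'"
    "exec q (s(x := (s x)(aval s i := aval s e))) u s'"
    by (auto simp: runs_def elim!: exec_SeqE exec_AssignE)
  then show "acost i + acost e + 1 \<le> T \<and>
    runs q (s(x := (s x)(aval s i := aval s e))) (T - (acost i + acost e + 1)) Q"
    unfolding runs_def by (intro conjI exI[of _ u] exI[of _ s']) auto
qed

lemma runs_Cond [simp]: "runs (Cond g p q) s T Q \<longleftrightarrow> bcost g + 1 \<le> T \<and>
    runs (if bval s g then p else q) s (T - (bcost g + 1)) Q"
proof
  assume "runs (Cond g p q) s T Q"
  then obtain t s' where "exec (Cond g p q) s t s'" "t \<le> T" "Q s'" by (auto simp: runs_def)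
  then show "bcost g + 1 \<le> T \<and> runs (if bval s g then p else q) s (T - (bcost g + 1)) Q"
    by (elim exec_CondE) (fastforce simp: runs_def)+
next
  assume *: "bcost g + 1 \<le> T \<and> runs (if bval s g then p else q) s (T - (bcost g + 1)) Q"
  then obtain t s' where "exec (if bval s g then p else q) s t s'" "t \<le> T - (bcost g + 1)" "Q s'"
    by (auto simp: runs_def)
  then show "runs (Cond g p q) s T Q"
    unfolding runs_def using *
    by (intro exI[of _ "bcost g + 1 + t"] exI[of _ s'])
      (auto intro: exec.CondTrue[simplified] exec.CondFalse[simplified] split: if_splits)
qed

text \<open>The continuation moves into the chosen branch, so that the rules for sequences apply
  again.\<close>

lemma runs_Seq_CondI:
  assumes "bcost g + 1 \<le> T" "runs (Seq (if bval s g then p else q) r) s (T - (bcost g + 1)) Q"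
  shows "runs (Seq (Cond g p q) r) s T Q"
proof -
  obtain t s' where t: "exec (Seq (if bval s g then p else q) r) s t s'" "t \<le> T - (bcost g + 1)" "Q s'"
    using assms by (auto simp: runs_def)
  from t(1) obtain t1 s1 t2 where *: "exec (if bval s g then p else q) s t1 s1" "exec r s1 t2 s'" "t = t1 + t2"
    by (auto elim!: exec_SeqE)
  have "exec (Cond g p q) s (bcost g + 1 + t1) s1"
    using *(1) by (auto intro: exec.CondTrue[of s g p t1 s1 q, simplified]
        exec.CondFalse[of s g q t1 s1 p, simplified] split: if_splits)
  from exec.Seq[OF this *(2)] show ?thesis
    unfolding runs_def using t(2,3) *(3) assms(1)
    by (intro exI[of _ "bcost g + 1 + t1 + t2"] exI[of _ s']) auto
qed

text \<open>\<open>k\<close> is a variant: it drops in every round and so bounds their number; one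
  further test ends the loop.\<close>

lemma runs_WhileI:
  assumes "I k s"
    and "\<And>k s. I k s \<Longrightarrow> bval s g \<Longrightarrow> runs p s T (\<lambda>s'. \<exists>k'<k. I k' s')"
  shows "runs (While g p) s (k * (T + bcost g + 1) + bcost g + 1) (\<lambda>s'. (\<exists>k. I k s') \<and> \<not> bval s' g)"
  using assms(1)
proof (induction k arbitrary: s rule: less_induct)
  case (less k)
  show ?case
  proof (cases "bval s g")
    case False
    then show ?thesis unfolding runs_def using less.prems
      by (intro exI[of _ "bcost g + 1"] exI[of _ s]) (auto intro: exec.WhileFalse[simplified])
  next
    case True
    obtain t s' k' where 1: "exec p s t s'" "t \<le> T" "k' < k" "I k' s'"
      using assms(2)[OF less.prems True] by (auto simp: runs_def)
    obtain u s'' where 2: "exec (While g p) s' u s''" "u \<le> k' * (T + bcost g + 1) + bcost g + 1"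
      "\<exists>k. I k s''" "\<not> bval s'' g"
      using less.IH[OF 1(3,4)] by (auto simp: runs_def)
    have "Suc k' * (T + bcost g + 1) \<le> k * (T + bcost g + 1)" using 1(3) by (intro mult_le_mono1) simp
    then have "bcost g + 1 + t + u \<le> k * (T + bcost g + 1) + bcost g + 1" using 1(2) 2(2) by simp
    then show ?thesis unfolding runs_def using exec.WhileTrue[OF True 1(1) 2(1)] 2(3,4) by blast
  qed
qed

section \<open>Counting loops with polynomial time bounds\<close>

definition For :: "string \<Rightarrow> string \<Rightarrow> com \<Rightarrow> com" where
  "For x y p = Seq (Assign x (Const 0) (Const 0))
     (While (Less (Read x (Const 0)) (Read y (Const 0)))
       (Seq p (Assign x (Const 0) (Plus (Read x (Const 0)) (Const 1)))))"

lemma writes_For [simp]: "writes (For x y p) = insert x (writes p)"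
  by (auto simp: For_def)

text \<open>Each nesting level raises the exponent by one and the constant by 22. A round costs 12
  beyond its body, 6 for the test and 6 for the increment; setup and last test cost 9. As
  \<open>1 \<le> N\<close>, this is at most \<open>21 * N\<close>. The body must establish the
  invariant for the state with the counter already raised, because the increment comes last.\<close>

lemma runs_For:
  assumes names: "x \<notin> writes p" "y \<notin> writes p" "x \<noteq> y"
    and N: "s0 y 0 = int N" "1 \<le> N"
    and init: "I 0 (s0(x := (s0 x)(0 := 0)))"
    and step: "\<And>i s. i < N \<Longrightarrow> I i s \<Longrightarrow> s x 0 = int i \<Longrightarrow> (\<And>v. v \<notin> insert x (writes p) \<Longrightarrow> s v = s0 v)
      \<Longrightarrow> runs p s (c * N ^ d) (\<lambda>s'. I (Suc i) (s'(x := (s' x)(0 := int (Suc i)))))"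
  shows "runs (For x y p) s0 ((c + 22) * N ^ Suc d) (I N)"
proof -
  \<comment> \<open>\<open>k\<close> counts the rounds left, so the counter holds
    \<open>N - k\<close>.\<close>
  let ?J = "\<lambda>k s. k \<le> N \<and> I (N - k) s \<and> s x 0 = int (N - k) \<and>
    (\<forall>v. v \<notin> insert x (writes p) \<longrightarrow> s v = s0 v)"
  let ?g = "Less (Read x (Const 0)) (Read y (Const 0))"
  let ?inc = "Assign x (Const 0) (Plus (Read x (Const 0)) (Const 1))"
  have body: "runs (Seq p ?inc) s (c * N ^ d + 6) (\<lambda>s'. \<exists>k'<k. ?J k' s')"
    if J: "?J k s" and g: "bval s ?g" for k s
  proof -
    have k: "N - k < N" "Suc (N - k) = N - (k - 1)" "0 < k" using J g N names by auto
    have "runs p s (c * N ^ d) (\<lambda>s'. I (Suc (N - k)) (s'(x := (s' x)(0 := int (Suc (N - k)))))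
        \<and> (\<forall>v. v \<notin> writes p \<longrightarrow> s' v = s v))"
      using J k by (intro runs_frame step) auto
    then show ?thesis
    proof (rule runs_SeqI)
      fix s' assume s': "I (Suc (N - k)) (s'(x := (s' x)(0 := int (Suc (N - k)))))
        \<and> (\<forall>v. v \<notin> writes p \<longrightarrow> s' v = s v)"
      let ?s = "s'(x := (s' x)(0 := int (Suc (N - k))))"
      have "s' x 0 = int (N - k)" using s' J names by auto
      then have val: "aval s' (Plus (Read x (Const 0)) (Const 1)) = int (Suc (N - k))" by simp
      have "I (N - (k - 1)) ?s" using s' k(2) by metis
      moreover have "\<forall>v. v \<notin> insert x (writes p) \<longrightarrow> ?s v = s0 v" using s' J by auto
      moreover have "?s x 0 = int (N - (k - 1))" using k(2) by simp
      moreover have "k - 1 \<le> N" using J by linarith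
      ultimately have "\<exists>k'<k. ?J k' ?s" using k(3) by (intro exI[of _ "k - 1"]) simp
      then show "runs ?inc s' 6 (\<lambda>s'. \<exists>k'<k. ?J k' s')"
        unfolding runs_Assign val by simp
    qed simp
  qed
  have "I N s'" if J: "(\<exists>k. ?J k s') \<and> \<not> bval s' ?g" for s'
  proof -
    from J obtain k where k: "?J k s'" "\<not> bval s' ?g" by blast
    then have "k = 0" using N names by auto
    then show ?thesis using k by simp
  qed
  moreover have "runs (While ?g (Seq p ?inc)) (s0(x := (s0 x)(0 := 0)))
    (N * (c * N ^ d + 6 + bcost ?g + 1) + bcost ?g + 1) (\<lambda>s'. (\<exists>k. ?J k s') \<and> \<not> bval s' ?g)"
    by (rule runs_WhileI[where I="?J"]) (use init body in auto)
  ultimately have while_loop: "runs (While ?g (Seq p ?inc)) (s0(x := (s0 x)(0 := 0)))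
    (N * (c * N ^ d + 6 + bcost ?g + 1) + bcost ?g + 1) (I N)"
    using runs_mono[OF _ order_refl] by blast
  have bound: "3 + (N * (c * N ^ d + 6 + bcost ?g + 1) + bcost ?g + 1) \<le> (c + 22) * N ^ Suc d"
  proof -
    define P where "P = N * N ^ d"
    have "N \<le> P" using N(2) by (simp add: P_def)
    moreover have "N * (c * N ^ d + 6 + bcost ?g + 1) = c * P + 12 * N" "(c + 22) * N ^ Suc d = c * P + 22 * P"
      by (simp_all add: P_def algebra_simps)
    moreover have "bcost ?g = 5" by simp
    ultimately show ?thesis using N(2) by linarith
  qed
  show ?thesis
    unfolding For_def
  proof (rule runs_SeqI[OF _ _ bound])
    show "runs (Assign x (Const 0) (Const 0)) s0 3 (\<lambda>s'. s' = s0(x := (s0 x)(0 := 0)))" by simp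
  qed (use while_loop in simp)
qed

section \<open>The program\<close>

lemma runs_Seq_Cond [simp]: "runs (Seq (Cond g p q) r) s T Q \<longleftrightarrow> bcost g + 1 \<le> T \<and>
    runs (Seq (if bval s g then p else q) r) s (T - (bcost g + 1)) Q"
proof
  assume "runs (Seq (Cond g p q) r) s T Q"
  then obtain t1 t2 s1 s' where 1: "exec (Cond g p q) s t1 s1" "exec r s1 t2 s'" "t1 + t2 \<le> T" "Q s'"
    by (auto simp: runs_def elim!: exec_SeqE)
  from 1(1) obtain t where t: "exec (if bval s g then p else q) s t s1" "t1 = bcost g + 1 + t"
    by (auto elim: exec_CondE)
  have "exec (Seq (if bval s g then p else q) r) s (t + t2) s'" using t(1) 1(2) by (rule exec.Seq)
  then show "bcost g + 1 \<le> T \<and> runs (Seq (if bval s g then p else q) r) s (T - (bcost g + 1)) Q"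
    unfolding runs_def using t(2) 1(3,4) by (intro conjI exI[of _ "t + t2"] exI[of _ s']) auto
qed (simp add: runs_Seq_CondI)

abbreviation rd :: "string \<Rightarrow> aexp" where
  "rd x \<equiv> Read x (Const 0)"

abbreviation elem :: "string \<Rightarrow> string \<Rightarrow> aexp" where
  "elem x i \<equiv> Read x (rd i)"

abbreviation set_var :: "string \<Rightarrow> aexp \<Rightarrow> com" where
  "set_var x e \<equiv> Assign x (Const 0) e"

abbreviation Or :: "bexp \<Rightarrow> bexp \<Rightarrow> bexp" where
  "Or g h \<equiv> Neg (Conj (Neg g) (Neg h))"

abbreviation cell :: "string \<Rightarrow> string \<Rightarrow> aexp" where
  "cell p q \<equiv> Plus (Times (rd p) (rd ''N'')) (rd q)"

section \<open>Inserting a vector into the echelon matrix\<close>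

definition store_row :: com where
  "store_row = For ''q'' ''N''
    (Seq (Assign ''B'' (cell ''p'' ''q'') (elem ''y'' ''q'')) (Assign ''y'' (rd ''q'') (Const 0)))"

definition reduce_vec :: com where
  "reduce_vec = For ''q'' ''N''
    (Assign ''y'' (rd ''q'') (Minus (Times (rd ''g'') (elem ''y'' ''q''))
      (Times (rd ''f'') (Read ''B'' (cell ''p'' ''q'')))))"

text \<open>The entry \<open>y[p]\<close> is saved in \<open>f\<close> because the reduction
  overwrites it before the row is finished. Storing clears \<open>y\<close>, so after a store the
  remaining values of \<open>p\<close> are skipped.\<close>

definition insert_vec :: com where
  "insert_vec = For ''p'' ''N'' (Cond (Equal (elem ''y'' ''p'') (Const 0)) Skip
    (Seq (set_var ''f'' (elem ''y'' ''p''))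
    (Seq (set_var ''g'' (Read ''B'' (cell ''p'' ''p'')))
    (Cond (Equal (rd ''g'') (Const 0))
      (Seq (set_var ''rank'' (Plus (rd ''rank'') (Const 1))) store_row)
      reduce_vec))))"

definition matrix_of :: "nat \<Rightarrow> state \<Rightarrow> nat \<Rightarrow> nat \<Rightarrow> int" where
  "matrix_of N s p q = s ''B'' (int p * int N + int q)"

definition vector_of :: "state \<Rightarrow> nat \<Rightarrow> int" where
  "vector_of s q = s ''y'' (int q)"

text \<open>Row-major addressing is injective: quotient and remainder by \<open>N\<close> recover
  row and column.\<close>

lemma cell_eq_iff:
  assumes "q < N" "q' < N"
  shows "int p * int N + int q = int p' * int N + int q' \<longleftrightarrow> p = p' \<and> q = q'"
proof -
  have "p = p' \<and> q = q'" if "p * N + q = p' * N + q'"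
  proof -
    have "(p * N + q) div N = p" "(p * N + q) mod N = q" "(p' * N + q') div N = p'" "(p' * N + q') mod N = q'"
      using assms by auto
    then show ?thesis using that by metis
  qed
  moreover have "int p * int N + int q = int p' * int N + int q' \<longleftrightarrow> p * N + q = p' * N + q'"
    by (metis of_nat_add of_nat_eq_iff of_nat_mult)
  ultimately show ?thesis by auto
qed

lemma runs_store_row:
  assumes N: "s ''N'' 0 = int N" "1 \<le> N" and p: "s ''p'' 0 = int p"
  shows "runs store_row s (52 * N) (\<lambda>s'. \<forall>q<N. vector_of s' q = 0 \<and>
    (\<forall>p'. matrix_of N s' p' q = (if p' = p then vector_of s q else matrix_of N s p' q)))"
proof -
  let ?I = "\<lambda>i s'. \<forall>q<N. vector_of s' q = (if q < i then 0 else vector_of s q) \<and>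
    (\<forall>p'. matrix_of N s' p' q = (if p' = p \<and> q < i then vector_of s q else matrix_of N s p' q))"
  have "runs store_row s ((30 + 22) * N ^ Suc 0) (?I N)"
    unfolding store_row_def
  proof (rule runs_For[where I="?I" and N=N])
    fix i s' assume i: "i < N" "?I i s'" "s' ''q'' 0 = int i"
      and fr: "\<And>v. v \<notin> insert ''q'' (writes (Seq (Assign ''B'' (cell ''p'' ''q'') (elem ''y'' ''q''))
        (Assign ''y'' (rd ''q'') (Const 0)))) \<Longrightarrow> s' v = s v"
    have v: "s' ''N'' 0 = int N" "s' ''p'' 0 = int p" using fr[of "''N''"] fr[of "''p''"] N p by simp_all
    have y: "s' ''y'' (int i) = vector_of s i" using i(1,2) by (auto simp: vector_of_def)
    show "runs (Seq (Assign ''B'' (cell ''p'' ''q'') (elem ''y'' ''q'')) (Assign ''y'' (rd ''q'') (Const 0)))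
      s' (30 * N ^ 0) (\<lambda>s'. ?I (Suc i) (s'(''q'' := (s' ''q'')(0 := int (Suc i)))))"
      using i(1,2) by (auto simp: v i(3) y vector_of_def matrix_of_def cell_eq_iff less_Suc_eq)
  qed (use N in \<open>simp_all add: vector_of_def matrix_of_def\<close>)
  then show ?thesis by (rule runs_mono) simp_all
qed

lemma runs_reduce_vec:
  assumes N: "s ''N'' 0 = int N" "1 \<le> N" and p: "s ''p'' 0 = int p"
  shows "runs reduce_vec s (52 * N) (\<lambda>s'. \<forall>q<N.
    vector_of s' q = s ''g'' 0 * vector_of s q - s ''f'' 0 * matrix_of N s p q)"
proof -
  let ?I = "\<lambda>i s'. \<forall>q<N. vector_of s' q =
    (if q < i then s ''g'' 0 * vector_of s q - s ''f'' 0 * matrix_of N s p q else vector_of s q)"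
  let ?body = "Assign ''y'' (rd ''q'') (Minus (Times (rd ''g'') (elem ''y'' ''q''))
      (Times (rd ''f'') (Read ''B'' (cell ''p'' ''q''))))"
  have "runs reduce_vec s ((30 + 22) * N ^ Suc 0) (?I N)"
    unfolding reduce_vec_def
  proof (rule runs_For[where I="?I" and N=N])
    fix i s' assume i: "i < N" "?I i s'" "s' ''q'' 0 = int i"
      and fr: "\<And>v. v \<notin> insert ''q'' (writes ?body) \<Longrightarrow> s' v = s v"
    have v: "s' ''N'' 0 = int N" "s' ''p'' 0 = int p" "s' ''B'' = s ''B''" "s' ''g'' = s ''g''" "s' ''f'' = s ''f''"
      using fr[of "''N''"] fr[of "''p''"] fr[of "''B''"] fr[of "''g''"] fr[of "''f''"] N p by simp_all
    have y: "s' ''y'' (int i) = vector_of s i" using i(1,2) by (auto simp: vector_of_def)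
    show "runs ?body s' (30 * N ^ 0) (\<lambda>s'. ?I (Suc i) (s'(''q'' := (s' ''q'')(0 := int (Suc i)))))"
      using i(1,2) by (auto simp: v i(3) y vector_of_def matrix_of_def less_Suc_eq)
  qed (use N in \<open>simp_all add: vector_of_def\<close>)
  then show ?thesis by (rule runs_mono) simp_all
qed

lemma writes_insert_vec: "writes insert_vec = {''p'', ''q'', ''f'', ''g'', ''rank'', ''B'', ''y''}"
  by (auto simp: insert_vec_def store_row_def reduce_vec_def)

lemma runs_insert_vec:
  assumes N: "s ''N'' 0 = int N" "1 \<le> N"
    and ech: "echelon N (matrix_of N s) r" "s ''rank'' 0 = int r"
  shows "runs insert_vec s (122 * N\<^sup>2) (\<lambda>s'. \<exists>r'. echelon N (matrix_of N s') r' \<and> s' ''rank'' 0 = int r' \<and>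
    span ((\<lambda>p. int_vec N (matrix_of N s' p)) ` {..<N}) = row_span N (matrix_of N s) (vector_of s))"
proof -
  \<comment> \<open>The first \<open>i\<close> entries of \<open>y\<close> are eliminated, and rows
    and \<open>y\<close> together span what they spanned at the start. At the end \<open>y\<close>
    is 0 and drops out of the span.\<close>
  let ?I = "\<lambda>i s'. \<exists>r'. echelon N (matrix_of N s') r' \<and> s' ''rank'' 0 = int r' \<and>
    (\<forall>q<min i N. vector_of s' q = 0) \<and> row_span N (matrix_of N s') (vector_of s') = row_span N (matrix_of N s) (vector_of s)"
  let ?body = "Cond (Equal (elem ''y'' ''p'') (Const 0)) Skip
    (Seq (set_var ''f'' (elem ''y'' ''p''))
    (Seq (set_var ''g'' (Read ''B'' (cell ''p'' ''p'')))
    (Cond (Equal (rd ''g'') (Const 0))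
      (Seq (set_var ''rank'' (Plus (rd ''rank'') (Const 1))) store_row)
      reduce_vec)))"
  have "runs insert_vec s ((100 + 22) * N ^ Suc 1) (?I N)"
    unfolding insert_vec_def
  proof (rule runs_For[where I="?I" and N=N])
    fix i s1 assume i: "i < N" "?I i s1" "s1 ''p'' 0 = int i"
      and fr: "\<And>v. v \<notin> insert ''p'' (writes ?body) \<Longrightarrow> s1 v = s v"
    have v: "s1 ''N'' 0 = int N"
      using fr[of "''N''"] N by (simp add: store_row_def reduce_vec_def)
    from i(2) obtain r' where r': "echelon N (matrix_of N s1) r'" "s1 ''rank'' 0 = int r'"
      "\<forall>q<i. vector_of s1 q = 0" "row_span N (matrix_of N s1) (vector_of s1) = row_span N (matrix_of N s) (vector_of s)"
      using i(1) by auto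
    let ?Q = "\<lambda>s'. ?I (Suc i) (s'(''p'' := (s' ''p'')(0 := int (Suc i))))"
    \<comment> \<open>Raising \<open>p\<close> touches neither matrix nor vector, so the next
      invariant may be shown for any \<open>M\<close> and \<open>y\<close> that agree with the
      memory on indices below \<open>N\<close>.\<close>
    have inv: "?Q s'" if "echelon N M r''" "s' ''rank'' 0 = int r''" "\<forall>q<Suc i. y q = 0"
      "row_span N M y = row_span N (matrix_of N s) (vector_of s)"
      "\<And>p q. p < N \<Longrightarrow> q < N \<Longrightarrow> matrix_of N s' p q = M p q" "\<And>q. q < N \<Longrightarrow> vector_of s' q = y q"
      for s' r'' M y
    proof (intro exI conjI)
      show "echelon N (matrix_of N (s'(''p'' := (s' ''p'')(0 := int (Suc i))))) r''"
        using that(1) by (subst echelon_cong[of N _ M]) (use that(5) in \<open>simp_all add: matrix_of_def\<close>)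
      show "row_span N (matrix_of N (s'(''p'' := (s' ''p'')(0 := int (Suc i)))))
        (vector_of (s'(''p'' := (s' ''p'')(0 := int (Suc i))))) = row_span N (matrix_of N s) (vector_of s)"
        using that(4) by (subst row_span_cong[of N _ M _ y])
          (use that(5,6) in \<open>simp_all add: matrix_of_def vector_of_def\<close>)
    qed (use that in \<open>simp_all add: vector_of_def\<close>)
    \<comment> \<open>Settles the truncated subtractions from the time budget: 100 covers the 33
      units before \<open>store_row\<close> and its own 52 already for \<open>N = 1\<close>.\<close>
    have budget: "k \<le> 100 * N - l" if "k + l \<le> 100" for k l using N(2) that by linarith
    show "runs ?body s1 (100 * N ^ 1) ?Q"
    proof (cases "vector_of s1 i = 0")
      case True
      have "?Q s1"
        by (rule inv[of "matrix_of N s1" r' s1 "vector_of s1"])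
          (use r' True in \<open>auto simp: less_Suc_eq\<close>)
      then show ?thesis using True i(3) N(2) by (simp add: vector_of_def)
    next
      case False
      define s2 where "s2 = s1(''f'' := (s1 ''f'')(0 := vector_of s1 i), ''g'' := (s1 ''g'')(0 := matrix_of N s1 i i))"
      have s2: "matrix_of N s2 = matrix_of N s1" "vector_of s2 = vector_of s1" "s2 ''N'' 0 = int N"
        "s2 ''p'' 0 = int i" "s2 ''rank'' = s1 ''rank''" "s2 ''g'' 0 = matrix_of N s1 i i" "s2 ''f'' 0 = vector_of s1 i"
        using v i(3) by (simp_all add: s2_def fun_eq_iff matrix_of_def vector_of_def)
      have red: "runs ?body s1 (100 * N ^ 1) ?Q \<longleftrightarrow> runs (Cond (Equal (rd ''g'') (Const 0))
        (Seq (set_var ''rank'' (Plus (rd ''rank'') (Const 1))) store_row) reduce_vec) s2 (100 * N - 22) ?Q"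
        using False i(3) v N(2)
        by (simp add: budget s2_def vector_of_def matrix_of_def del: One_nat_def split del: if_split)
      show ?thesis
      proof (cases "matrix_of N s1 i i = 0")
        case True
        define s3 where "s3 = s2(''rank'' := (s2 ''rank'')(0 := int (Suc r')))"
        have s3: "matrix_of N s3 = matrix_of N s1" "vector_of s3 = vector_of s1" "s3 ''N'' 0 = int N"
          "s3 ''p'' 0 = int i" "s3 ''rank'' 0 = int (Suc r')"
          using s2 by (simp_all add: s3_def fun_eq_iff matrix_of_def vector_of_def)
        have st: "runs store_row s3 (52 * N) ?Q"
        proof (rule runs_mono[OF runs_frame[OF runs_store_row[of s3 N i, OF s3(3) N(2) s3(4)]] order_refl])
          fix s' assume s': "(\<forall>q<N. vector_of s' q = 0 \<and> (\<forall>p'. matrix_of N s' p' q =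
              (if p' = i then vector_of s3 q else matrix_of N s3 p' q))) \<and>
              (\<forall>v. v \<notin> writes store_row \<longrightarrow> s' v = s3 v)"
          have rank: "s' ''rank'' = s3 ''rank''" using s' by (simp add: store_row_def)
          have yi: "\<And>q. q < i \<Longrightarrow> vector_of s1 q = 0" using r'(3) by simp
          show "?Q s'"
          proof (rule inv)
            show "echelon N ((matrix_of N s1)(i := vector_of s1)) (Suc r')"
              by (rule echelon_store(1)[of N "matrix_of N s1" r' i "vector_of s1", OF r'(1) i(1) True False yi])
            show "row_span N ((matrix_of N s1)(i := vector_of s1)) (\<lambda>_. 0) = row_span N (matrix_of N s) (vector_of s)"
              using echelon_store(2)[of N "matrix_of N s1" r' i "vector_of s1", OF r'(1) i(1) True False yi] r'(4) by simp
          qed (use s' s3 rank in simp_all)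
        qed
        have "runs store_row s3 (100 * N - 33) ?Q"
          by (rule runs_mono[OF st]) (use N(2) in auto)
        moreover have "runs (Cond (Equal (rd ''g'') (Const 0))
          (Seq (set_var ''rank'' (Plus (rd ''rank'') (Const 1))) store_row) reduce_vec) s2 (100 * N - 22) ?Q \<longleftrightarrow>
          runs store_row s3 (100 * N - 33) ?Q"
          using True N(2) s2 r'(2) by (simp add: budget s3_def add.commute del: One_nat_def)
        ultimately show ?thesis using red by blast
      next
        case False
        have st: "runs reduce_vec s2 (52 * N) ?Q"
        proof (rule runs_mono[OF runs_frame[OF runs_reduce_vec[of s2 N i, OF s2(3) N(2) s2(4)]] order_refl])
          fix s' assume s': "(\<forall>q<N. vector_of s' q = s2 ''g'' 0 * vector_of s2 q - s2 ''f'' 0 * matrix_of N s2 i q) \<and>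
              (\<forall>v. v \<notin> writes reduce_vec \<longrightarrow> s' v = s2 v)"
          have fr': "s' ''rank'' = s1 ''rank''" "s' ''B'' = s1 ''B''"
            using s' s2(5) by (simp_all add: reduce_vec_def s2_def)
          show "?Q s'"
          proof (rule inv)
            show "echelon N (matrix_of N s1) r'" by (rule r'(1))
            show "row_span N (matrix_of N s1) (\<lambda>q. matrix_of N s1 i i * vector_of s1 q - vector_of s1 i * matrix_of N s1 i q)
              = row_span N (matrix_of N s) (vector_of s)"
              using row_span_reduce[of i N "matrix_of N s1" "vector_of s1", OF i(1) False] r'(4) by simp
            \<comment> \<open>Entry \<open>i\<close> cancels crosswise; the earlier ones are 0 in
              \<open>y\<close> and, left of the diagonal, in row \<open>i\<close>.\<close>
            show "\<forall>q<Suc i. matrix_of N s1 i i * vector_of s1 q - vector_of s1 i * matrix_of N s1 i q = 0"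
              using r'(1,3) i(1) by (auto simp: less_Suc_eq echelon_def)
          qed (use s' s2 fr' r'(2) in \<open>simp_all add: matrix_of_def\<close>)
        qed
        have "runs reduce_vec s2 (100 * N - 27) ?Q"
          by (rule runs_mono[OF st]) (use N(2) in auto)
        moreover have "runs (Cond (Equal (rd ''g'') (Const 0))
          (Seq (set_var ''rank'' (Plus (rd ''rank'') (Const 1))) store_row) reduce_vec) s2 (100 * N - 22) ?Q \<longleftrightarrow>
          runs reduce_vec s2 (100 * N - 27) ?Q"
          using False N(2) s2 by (simp add: budget del: One_nat_def)
        ultimately show ?thesis using red by blast
      qed
    qed
  next
    show "?I 0 (s(''p'' := (s ''p'')(0 := 0)))"
      using ech by (intro exI[of _ r])
        (simp add: matrix_of_def[abs_def] vector_of_def[abs_def])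
  qed (use N in \<open>simp_all add: store_row_def reduce_vec_def\<close>)
  then show ?thesis
  proof (rule runs_mono)
    show "(100 + 22) * N ^ Suc 1 \<le> 122 * N\<^sup>2" by (simp add: power2_eq_square)
    fix s' assume "?I N s'"
    then show "\<exists>r'. echelon N (matrix_of N s') r' \<and> s' ''rank'' 0 = int r' \<and>
      span ((\<lambda>p. int_vec N (matrix_of N s' p)) ` {..<N}) = row_span N (matrix_of N s) (vector_of s)"
      using row_span_zero[of N "vector_of s'" "matrix_of N s'"] by auto
  qed
qed

section \<open>Inspecting neighbours and stepping the odometer as programs\<close>

definition fill_vec :: com where
  "fill_vec = For ''j'' ''N''
    (Seq (Assign ''y'' (rd ''j'') (elem ''x'' ''j''))
    (Seq (Cond (Equal (rd ''j'') (rd ''i''))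
      (Assign ''y'' (rd ''j'') (Minus (Const 1) (elem ''y'' ''j''))) Skip)
    (Seq (Cond (Equal (rd ''j'') (rd ''k''))
      (Assign ''y'' (rd ''j'') (Minus (Const 1) (elem ''y'' ''j''))) Skip)
    (Seq (set_var ''w'' (Plus (rd ''w'') (Times (elem ''a'' ''j'') (elem ''y'' ''j''))))
      (set_var ''v'' (Plus (rd ''v'') (Times (elem ''alpha'' ''j'') (elem ''y'' ''j'')))))))) "

text \<open>A flip at position \<open>n\<close> may change \<open>y[n]\<close>, so the lifting
  coordinate is written only after the filling.\<close>

definition probe :: com where
  "probe = Seq (set_var ''w'' (Const 0)) (Seq (set_var ''v'' (Const 0)) (Seq fill_vec
    (Seq (Assign ''y'' (rd ''n'') (Const 1))
    (Cond (Less (rd ''b'') (rd ''w'')) Skip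
    (Cond (Less (rd ''beta'') (rd ''v'')) (set_var ''valid'' (Const 0))
    (Cond (Equal (rd ''v'') (rd ''beta'')) insert_vec Skip))))))"

definition probe_all :: com where
  "probe_all = For ''i'' ''N'' (For ''k'' ''N'' probe)"

text \<open>\<open>m = N\<close> means that nothing has been found yet; as \<open>N = n + 1\<close>,
  this differs from every item.\<close>

definition find_next :: com where
  "find_next = Seq (set_var ''m'' (rd ''N'')) (For ''i'' ''N''
    (Cond (Conj (Equal (elem ''x'' ''i'') (Const 0)) (Conj (Less (Const 0) (elem ''alpha'' ''i''))
        (Or (Equal (rd ''m'') (rd ''N'')) (Or (Less (elem ''alpha'' ''i'') (elem ''alpha'' ''m''))
          (Conj (Equal (elem ''alpha'' ''i'') (elem ''alpha'' ''m''))
            (Less (elem ''a'' ''i'') (elem ''a'' ''m'')))))))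
      (set_var ''m'' (rd ''i'')) Skip))"

definition clear_lower :: com where
  "clear_lower = For ''j'' ''N''
    (Cond (Less (elem ''alpha'' ''j'') (elem ''alpha'' ''m'')) (Assign ''x'' (rd ''j'') (Const 0)) Skip)"

definition advance :: com where
  "advance = Seq find_next (Cond (Equal (rd ''m'') (rd ''N'')) (set_var ''go'' (Const 0))
    (Seq (Assign ''x'' (rd ''m'') (Const 1)) clear_lower))"

text \<open>
  All loops run over \<open>n + 1\<close> cells: cell \<open>n\<close> of the inputs \<open>a\<close> and \<open>alpha\<close> is \<open>0\<close>, and in \<open>y\<close> it
  holds the coordinate added by lifting.
\<close>

definition facet_program :: com where
  "facet_program = Seq (set_var ''N'' (Plus (rd ''n'') (Const 1)))
    (Seq (set_var ''valid'' (Const 1)) (Seq (set_var ''go'' (Const 1))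
    (Seq (While (Equal (rd ''go'') (Const 1)) (Seq probe_all advance))
    (Cond (Conj (Equal (rd ''valid'') (Const 1)) (Equal (rd ''rank'') (rd ''n'')))
      (set_var ''result'' (Const 1)) Skip))))"

lemma writes_fill_vec: "writes fill_vec = {''j'', ''y'', ''w'', ''v''}"
  by (auto simp: fill_vec_def)

lemma writes_probe: "writes probe =
  {''j'', ''y'', ''w'', ''v'', ''valid'', ''p'', ''q'', ''f'', ''g'', ''rank'', ''B''}"
  by (auto simp: probe_def writes_fill_vec writes_insert_vec)

lemma writes_probe_all: "writes probe_all =
  {''i'', ''k'', ''j'', ''y'', ''w'', ''v'', ''valid'', ''p'', ''q'', ''f'', ''g'', ''rank'', ''B''}"
  by (auto simp: probe_all_def writes_probe)

lemma writes_find_next: "writes find_next = {''m'', ''i''}"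
  by (auto simp: find_next_def)

lemma writes_advance: "writes advance = {''m'', ''i'', ''j'', ''x'', ''go''}"
  by (auto simp: advance_def writes_find_next clear_lower_def)

section \<open>Correctness and running time of the program parts\<close>

lemma runs_fill_vec:
  assumes N: "s ''N'' 0 = int N" "1 \<le> N"
    and wv: "s ''w'' 0 = 0" "s ''v'' 0 = 0" and ik: "s ''i'' 0 = int i" "s ''k'' 0 = int k"
    and x: "\<forall>q<N. s ''x'' (int q) = of_bool (q \<in> X)"
  defines "y \<equiv> \<lambda>q. of_bool ((q \<in> X) \<noteq> ((q = i) \<noteq> (q = k)))"
  shows "runs fill_vec s (92 * N) (\<lambda>s'. (\<forall>q<N. vector_of s' q = y q) \<and>
    s' ''w'' 0 = (\<Sum>q<N. s ''a'' (int q) * y q) \<and> s' ''v'' 0 = (\<Sum>q<N. s ''alpha'' (int q) * y q))"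
proof -
  let ?I = "\<lambda>j s'. (\<forall>q<j. vector_of s' q = y q) \<and>
    s' ''w'' 0 = (\<Sum>q<j. s ''a'' (int q) * y q) \<and> s' ''v'' 0 = (\<Sum>q<j. s ''alpha'' (int q) * y q)"
  let ?body = "Seq (Assign ''y'' (rd ''j'') (elem ''x'' ''j''))
    (Seq (Cond (Equal (rd ''j'') (rd ''i''))
      (Assign ''y'' (rd ''j'') (Minus (Const 1) (elem ''y'' ''j''))) Skip)
    (Seq (Cond (Equal (rd ''j'') (rd ''k''))
      (Assign ''y'' (rd ''j'') (Minus (Const 1) (elem ''y'' ''j''))) Skip)
    (Seq (set_var ''w'' (Plus (rd ''w'') (Times (elem ''a'' ''j'') (elem ''y'' ''j''))))
      (set_var ''v'' (Plus (rd ''v'') (Times (elem ''alpha'' ''j'') (elem ''y'' ''j'')))))))"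
  have "runs fill_vec s ((70 + 22) * N ^ Suc 0) (?I N)"
    unfolding fill_vec_def
  proof (rule runs_For[where I="?I" and N=N])
    fix j s1 assume j: "j < N" "?I j s1" "s1 ''j'' 0 = int j"
      and fr: "\<And>v. v \<notin> insert ''j'' (writes ?body) \<Longrightarrow> s1 v = s v"
    have v: "s1 ''i'' 0 = int i" "s1 ''k'' 0 = int k" "s1 ''x'' (int j) = of_bool (j \<in> X)"
      "s1 ''a'' = s ''a''" "s1 ''alpha'' = s ''alpha''"
      using fr[of "''i''"] fr[of "''k''"] fr[of "''x''"] fr[of "''a''"] fr[of "''alpha''"] ik x j(1)
      by simp_all
    have yj: "y j = (if i = j \<longleftrightarrow> k = j then of_bool (j \<in> X) else 1 - of_bool (j \<in> X))"
      by (auto simp: y_def)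
    show "runs ?body s1 (70 * N ^ 0) (\<lambda>s'. ?I (Suc j) (s'(''j'' := (s' ''j'')(0 := int (Suc j)))))"
      using j(2) by (cases "i = j"; cases "k = j")
        (simp_all add: v j(3) yj vector_of_def All_less_Suc del: One_nat_def)
  qed (use N wv in simp_all)
  then show ?thesis by (rule runs_mono) simp_all
qed

context knapsack
begin

definition input_loaded :: "nat \<Rightarrow> nat \<Rightarrow> state \<Rightarrow> bool" where
  "input_loaded b \<beta> s \<longleftrightarrow> s ''n'' 0 = int n \<and> s ''N'' 0 = int (Suc n) \<and> s ''a'' = vector n a \<and>
    s ''alpha'' = vector n \<alpha> \<and> s ''b'' 0 = int b \<and> s ''beta'' 0 = int \<beta>"

lemma input_loaded_frame:
  assumes "input_loaded b \<beta> s" "\<And>v. v \<notin> A \<Longrightarrow> s' v = s v"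
    "A \<inter> {''n'', ''N'', ''a'', ''alpha'', ''b'', ''beta''} = {}"
  shows "input_loaded b \<beta> s'"
  using assms(1,3) assms(2)[of "''n''"] assms(2)[of "''N''"] assms(2)[of "''a''"]
    assms(2)[of "''alpha''"] assms(2)[of "''b''"] assms(2)[of "''beta''"]
  by (auto simp: input_loaded_def)

definition holds_set :: "nat set \<Rightarrow> state \<Rightarrow> bool" where
  "holds_set X s \<longleftrightarrow> (\<forall>q<Suc n. s ''x'' (int q) = of_bool (q \<in> X))"

text \<open>\<open>Z\<close> is the family inspected so far. Only the span of the rows is recorded,
  since elimination does not keep the lifted points themselves.\<close>

definition collected :: "nat \<Rightarrow> nat \<Rightarrow> nat set set \<Rightarrow> state \<Rightarrow> bool" where
  "collected b \<beta> Z s \<longleftrightarrow>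
    s ''valid'' 0 = of_bool (\<forall>Y\<in>Z. sum a Y \<le> b \<longrightarrow> sum \<alpha> Y \<le> \<beta>) \<and>
    (\<exists>r. echelon (Suc n) (matrix_of (Suc n) s) r \<and> s ''rank'' 0 = int r \<and>
      span ((\<lambda>p. int_vec (Suc n) (matrix_of (Suc n) s p)) ` {..<Suc n}) =
      span (lifted_char_vec n ` {Y \<in> Z. sum a Y \<le> b \<and> sum \<alpha> Y = \<beta>}))"

lemma collected_frame:
  assumes "collected b \<beta> Z s" "s' ''valid'' = s ''valid''" "s' ''rank'' = s ''rank''" "s' ''B'' = s ''B''"
  shows "collected b \<beta> Z s'"
proof -
  have "matrix_of (Suc n) s' = matrix_of (Suc n) s" using assms by (simp add: fun_eq_iff matrix_of_def)
  then show ?thesis using assms by (simp add: collected_def)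
qed

text \<open>The input arrays are 0 at \<open>n\<close>, so it does not matter whether position
  \<open>n\<close> has been flipped.\<close>

lemma sum_vector_flip_two:
  "(\<Sum>q<Suc n. vector n c (int q) * of_bool ((q \<in> X) \<noteq> ((q = i) \<noteq> (q = k)))) = int (sum c (flip_two X i k))"
proof -
  have "(\<Sum>q<Suc n. vector n c (int q) * of_bool ((q \<in> X) \<noteq> ((q = i) \<noteq> (q = k)))) =
    (\<Sum>q\<in>flip_two X i k. int (c q))"
    by (rule sum.mono_neutral_cong_right) (auto simp: flip_two_def vector_def)
  then show ?thesis by simp
qed

lemma flip_two_subset: "flip_two X i k \<subseteq> {..<n}"
  by (auto simp: flip_two_def)

text \<open>A set that is too heavy or strictly below the level changes nothing, a feasible set
  above it refutes validity, and a set on the face contributes one generator.\<close>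

lemma runs_probe:
  assumes inp: "input_loaded b \<beta> s" and X: "holds_set X s"
    and ik: "s ''i'' 0 = int i" "s ''k'' 0 = int k" and Z: "collected b \<beta> Z s"
  shows "runs probe s (300 * (Suc n)\<^sup>2) (collected b \<beta> (insert (flip_two X i k) Z))"
proof -
  let ?N = "Suc n" and ?Y = "flip_two X i k"
  define s0 where "s0 = s(''w'' := (s ''w'')(0 := 0), ''v'' := (s ''v'')(0 := 0))"
  let ?y = "\<lambda>q. of_bool ((q \<in> X) \<noteq> ((q = i) \<noteq> (q = k))) :: int"
  have s0: "s0 ''N'' 0 = int ?N" "s0 ''w'' 0 = 0" "s0 ''v'' 0 = 0" "s0 ''i'' 0 = int i"
    "s0 ''k'' 0 = int k" "\<forall>q<?N. s0 ''x'' (int q) = of_bool (q \<in> X)" "s0 ''a'' = vector n a"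
    "s0 ''alpha'' = vector n \<alpha>"
    using inp X ik by (simp_all add: s0_def input_loaded_def holds_set_def)
  define rest where "rest = Seq (Assign ''y'' (rd ''n'') (Const 1))
    (Cond (Less (rd ''b'') (rd ''w'')) Skip
    (Cond (Less (rd ''beta'') (rd ''v'')) (set_var ''valid'' (Const 0))
    (Cond (Equal (rd ''v'') (rd ''beta'')) insert_vec Skip)))"
  have "runs (Seq fill_vec rest) s0 (300 * ?N\<^sup>2 - 6) (collected b \<beta> (insert ?Y Z))"
  proof (rule runs_SeqI[OF runs_frame[OF runs_fill_vec[OF s0(1) _ s0(2-6)]]])
    \<comment> \<open>For \<open>?N = 1\<close> this reads 244 \<le> 294, and the gap widens with
      \<open>?N\<close>.\<close>
    show "92 * ?N + (122 * ?N\<^sup>2 + 30) \<le> 300 * ?N\<^sup>2 - 6"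
      by (simp add: power2_eq_square)
    fix s1 assume "((\<forall>q<?N. vector_of s1 q = ?y q) \<and>
        s1 ''w'' 0 = (\<Sum>q<?N. s0 ''a'' (int q) * ?y q) \<and>
        s1 ''v'' 0 = (\<Sum>q<?N. s0 ''alpha'' (int q) * ?y q)) \<and>
        (\<forall>v. v \<notin> writes fill_vec \<longrightarrow> s1 v = s0 v)"
    then have y: "\<And>q. q < ?N \<Longrightarrow> vector_of s1 q = ?y q"
      and w: "s1 ''w'' 0 = int (sum a ?Y)" and v: "s1 ''v'' 0 = int (sum \<alpha> ?Y)"
      and fr: "\<And>v. v \<notin> {''j'', ''y'', ''w'', ''v''} \<Longrightarrow> s1 v = s v"
      unfolding s0(7,8) sum_vector_flip_two writes_fill_vec by (simp_all add: s0_def)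
    define s2 where "s2 = s1(''y'' := (s1 ''y'')(int n := 1))"
    have inp2: "s2 ''n'' 0 = int n" "s2 ''N'' 0 = int ?N" "s2 ''b'' 0 = int b" "s2 ''beta'' 0 = int \<beta>"
      "s2 ''w'' 0 = int (sum a ?Y)" "s2 ''v'' 0 = int (sum \<alpha> ?Y)"
      using inp w v by (simp_all add: s2_def fr input_loaded_def)
    have Z2: "collected b \<beta> Z s2"
      by (rule collected_frame[OF Z]) (simp_all add: s2_def fr)
    have vec: "int_vec ?N (vector_of s2) = lifted_char_vec n ?Y"
    proof (rule poly_mapping_eqI)
      fix q
      show "Poly_Mapping.lookup (int_vec ?N (vector_of s2)) q = Poly_Mapping.lookup (lifted_char_vec n ?Y) q"
        unfolding lookup_int_vec lookup_lifted_char_vec[OF flip_two_subset]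
        using y[of q] flip_two_subset[of X i k] by (auto simp: s2_def vector_of_def flip_two_def)
    qed
    let ?Q = "collected b \<beta> (insert ?Y Z)"
    have "runs (Cond (Less (rd ''b'') (rd ''w'')) Skip
      (Cond (Less (rd ''beta'') (rd ''v'')) (set_var ''valid'' (Const 0))
      (Cond (Equal (rd ''v'') (rd ''beta'')) insert_vec Skip))) s2 (122 * ?N\<^sup>2 + 26) ?Q"
    proof (cases "sum a ?Y \<le> b \<and> sum \<alpha> ?Y = \<beta>")
      case True
      then have ins: "{Y \<in> insert ?Y Z. sum a Y \<le> b \<and> sum \<alpha> Y = \<beta>} =
        insert ?Y {Y \<in> Z. sum a Y \<le> b \<and> sum \<alpha> Y = \<beta>}" by auto
      from Z2 obtain r where r: "echelon ?N (matrix_of ?N s2) r" "s2 ''rank'' 0 = int r"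
        "span ((\<lambda>p. int_vec ?N (matrix_of ?N s2 p)) ` {..<?N}) =
          span (lifted_char_vec n ` {Y \<in> Z. sum a Y \<le> b \<and> sum \<alpha> Y = \<beta>})"
        by (auto simp: collected_def)
      have "row_span ?N (matrix_of ?N s2) (vector_of s2) =
        span (lifted_char_vec n ` {Y \<in> insert ?Y Z. sum a Y \<le> b \<and> sum \<alpha> Y = \<beta>})"
        unfolding row_span_def vec ins image_insert using r(3) by (simp only: span_insert)
      then have "runs insert_vec s2 (122 * ?N\<^sup>2) ?Q"
        by (intro runs_mono[OF runs_frame[OF runs_insert_vec[OF inp2(2) _ r(1,2)]]])
          (use Z2 True in \<open>auto simp: collected_def writes_insert_vec\<close>)
      then show ?thesis
        using True inp2 by (auto simp del: One_nat_def of_nat_sum elim: runs_mono)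
    next
      case False
      then have ins: "{Y \<in> insert ?Y Z. sum a Y \<le> b \<and> sum \<alpha> Y = \<beta>} =
        {Y \<in> Z. sum a Y \<le> b \<and> sum \<alpha> Y = \<beta>}" by auto
      have "?Q (s2(''valid'' := (s2 ''valid'')(0 := 0)))" if "sum a ?Y \<le> b" "\<beta> < sum \<alpha> ?Y"
      proof -
        have "matrix_of ?N (s2(''valid'' := (s2 ''valid'')(0 := 0))) = matrix_of ?N s2"
          by (simp add: fun_eq_iff matrix_of_def)
        then show ?thesis using Z2 that unfolding collected_def ins by auto
      qed
      moreover have "?Q s2" if "b < sum a ?Y \<or> sum \<alpha> ?Y < \<beta>"
        using Z2 that unfolding collected_def ins by auto
      ultimately show ?thesis using False inp2 by (auto simp: not_less simp del: One_nat_def of_nat_sum)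
    qed
    then show "runs rest s1 (122 * ?N\<^sup>2 + 30) ?Q"
      using inp by (simp add: rest_def fr input_loaded_def s2_def del: One_nat_def fun_upd_apply)
  qed simp
  then show ?thesis
    by (simp add: probe_def rest_def s0_def power2_eq_square del: One_nat_def)
qed

text \<open>Two nested loops turn 300 times the square into 344 times the fourth power, 22 being
  added per level.\<close>

lemma runs_probe_all:
  assumes inp: "input_loaded b \<beta> s" and X: "holds_set X s" and Z: "collected b \<beta> Z s"
  shows "runs probe_all s (344 * Suc n ^ 4) (collected b \<beta> (Z \<union> neighbours X))"
proof -
  let ?N = "Suc n"
  let ?I = "\<lambda>i. collected b \<beta> (Z \<union> (\<Union>i'<i. flip_two X i' ` {..<?N}))"
  have col: "collected b \<beta> Z' (s'(v := f)) \<longleftrightarrow> collected b \<beta> Z' s'" if "v = ''i'' \<or> v = ''k''" for Z' s' v f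
    using that by (auto intro: collected_frame elim!: collected_frame)
  have "runs probe_all s ((322 + 22) * ?N ^ Suc 3) (?I ?N)"
    unfolding probe_all_def
  proof (rule runs_For[where I="?I" and N="?N"])
    fix i s1 assume i: "i < ?N" "?I i s1" "s1 ''i'' 0 = int i"
      and fr1: "\<And>v. v \<notin> insert ''i'' (writes (For ''k'' ''N'' probe)) \<Longrightarrow> s1 v = s v"
    have inp1: "input_loaded b \<beta> s1"
      by (rule input_loaded_frame[OF inp, where A="insert ''i'' (writes (For ''k'' ''N'' probe))"])
        (simp_all add: fr1 writes_probe)
    let ?J = "\<lambda>k. collected b \<beta> (Z \<union> (\<Union>i'<i. flip_two X i' ` {..<?N}) \<union> flip_two X i ` {..<k})"
    have "runs (For ''k'' ''N'' probe) s1 ((300 + 22) * ?N ^ Suc 2) (?J ?N)"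
    proof (rule runs_For[where I="?J" and N="?N"])
      fix k s2 assume k: "k < ?N" "?J k s2" "s2 ''k'' 0 = int k"
        and fr2: "\<And>v. v \<notin> insert ''k'' (writes probe) \<Longrightarrow> s2 v = s1 v"
      have inp2: "input_loaded b \<beta> s2"
        by (rule input_loaded_frame[OF inp1, where A="insert ''k'' (writes probe)"])
          (simp_all add: fr2 writes_probe)
      have "holds_set X s2" "s2 ''i'' 0 = int i"
        using X fr1[of "''x''"] fr2[of "''x''"] fr2[of "''i''"] i(3)
        by (simp_all add: holds_set_def writes_probe)
      from runs_probe[OF inp2 this k(3,2)]
      show "runs probe s2 (300 * ?N ^ 2) (\<lambda>s'. ?J (Suc k) (s'(''k'' := (s' ''k'')(0 := int (Suc k)))))"
        by (simp add: col lessThan_Suc[of k])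
    qed (use i(2) inp1 in \<open>simp_all add: col writes_probe input_loaded_def\<close>)
    then show "runs (For ''k'' ''N'' probe) s1 (322 * ?N ^ 3)
      (\<lambda>s'. ?I (Suc i) (s'(''i'' := (s' ''i'')(0 := int (Suc i)))))"
      by (rule runs_mono) (simp_all add: col lessThan_Suc[of i] Un_ac numeral_eq_Suc)
  qed (use Z inp in \<open>simp_all add: col writes_probe input_loaded_def\<close>)
  then show ?thesis
    by (rule runs_mono) (simp_all add: neighbours_def numeral_eq_Suc)
qed

lemma runs_find_next:
  assumes inp: "input_loaded b \<beta> s" and X: "holds_set X s"
  shows "runs find_next s (90 * Suc n) (\<lambda>s'. pos \<subseteq> X \<and> s' ''m'' 0 = int (Suc n) \<or>
    (\<exists>m. is_next X m \<and> s' ''m'' 0 = int m))"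
proof -
  let ?N = "Suc n"
  let ?le = "\<lambda>m i. \<alpha> m < \<alpha> i \<or> \<alpha> m = \<alpha> i \<and> a m \<le> a i"
  let ?I = "\<lambda>i s'. (s' ''m'' 0 = int ?N \<and> (\<forall>q\<in>pos - X. \<not> q < i)) \<or>
    (\<exists>m\<in>pos - X. s' ''m'' 0 = int m \<and> (\<forall>q\<in>pos - X. q < i \<longrightarrow> ?le m q))"
  let ?g = "Conj (Equal (elem ''x'' ''i'') (Const 0)) (Conj (Less (Const 0) (elem ''alpha'' ''i''))
        (Or (Equal (rd ''m'') (rd ''N'')) (Or (Less (elem ''alpha'' ''i'') (elem ''alpha'' ''m''))
          (Conj (Equal (elem ''alpha'' ''i'') (elem ''alpha'' ''m''))
            (Less (elem ''a'' ''i'') (elem ''a'' ''m''))))))"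
  let ?body = "Cond ?g (set_var ''m'' (rd ''i'')) Skip"
  define s0 where "s0 = s(''m'' := (s ''m'')(0 := int ?N))"
  have inp0: "input_loaded b \<beta> s0" and X0: "holds_set X s0"
    using inp X by (simp_all add: s0_def input_loaded_def holds_set_def)
  have "runs (For ''i'' ''N'' ?body) s0 ((60 + 22) * ?N ^ Suc 0) (?I ?N)"
  proof (rule runs_For[where I="?I" and N="?N"])
    fix i s1 assume i: "i < ?N" "?I i s1" "s1 ''i'' 0 = int i"
      and fr: "\<And>v. v \<notin> insert ''i'' (writes ?body) \<Longrightarrow> s1 v = s0 v"
    have v: "s1 ''N'' 0 = int ?N" "s1 ''alpha'' = vector n \<alpha>" "s1 ''a'' = vector n a"
      "s1 ''x'' (int i) = of_bool (i \<in> X)"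
      using fr[of "''N''"] fr[of "''alpha''"] fr[of "''a''"] fr[of "''x''"] inp0 X0 i(1)
      by (simp_all add: input_loaded_def holds_set_def)
    \<comment> \<open>Both sides are false at \<open>i = n\<close>, where the input array reads 0;
      so position \<open>n\<close> is never taken for an item.\<close>
    have elig: "s1 ''x'' (int i) = 0 \<and> 0 < vector n \<alpha> (int i) \<longleftrightarrow> i \<in> pos - X"
      using i(1) by (auto simp: v vector_def pos_def)
    have nlt: "q < Suc i \<longleftrightarrow> q < i \<or> q = i" for q by auto
    let ?Q = "\<lambda>s'. ?I (Suc i) (s'(''i'' := (s' ''i'')(0 := int (Suc i))))"
    have skip: "runs ?body s1 (60 * ?N ^ 0) ?Q" if "\<not> bval s1 ?g" "?I (Suc i) s1"
      unfolding runs_Cond if_not_P[OF that(1)] runs_Skip using that(2) by simp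
    have update: "runs ?body s1 (60 * ?N ^ 0) ?Q"
      if "bval s1 ?g" "i \<in> pos - X" "\<forall>q\<in>pos - X. q < Suc i \<longrightarrow> ?le i q"
      unfolding runs_Cond if_P[OF that(1)] runs_Assign
      by (intro conjI disjI2 bexI[OF _ that(2)]) (use that(3) i(3) in simp_all)
    consider "i \<notin> pos - X" | "i \<in> pos - X" "s1 ''m'' 0 = int ?N" "\<forall>q\<in>pos - X. \<not> q < i"
      | m where "i \<in> pos - X" "m \<in> pos - X" "s1 ''m'' 0 = int m" "\<forall>q\<in>pos - X. q < i \<longrightarrow> ?le m q"
      using i(2) by blast
    then show "runs ?body s1 (60 * ?N ^ 0) ?Q"
    proof cases
      case 1
      then have "\<not> bval s1 ?g" using elig by (auto simp: i(3) v(2))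
      moreover have "?I (Suc i) s1" using i(2) 1 unfolding nlt by blast
      ultimately show ?thesis by (intro skip)
    next
      case 2
      then have "bval s1 ?g" using elig by (auto simp: i(3) v)
      moreover have "\<forall>q\<in>pos - X. q < Suc i \<longrightarrow> ?le i q" using 2 unfolding nlt by blast
      ultimately show ?thesis using 2(1) by (intro update)
    next
      case (3 m)
      have mn: "m < n" "i < n" using 3 by (auto simp: pos_def)
      have g: "bval s1 ?g \<longleftrightarrow> \<not> ?le m i"
      proof -
        have "s1 ''x'' (int i) = 0" "0 < \<alpha> i" using elig 3(1) by (auto simp: pos_def)
        moreover have "s1 ''alpha'' (int i) = int (\<alpha> i)" "s1 ''alpha'' (int m) = int (\<alpha> m)"
          "s1 ''a'' (int i) = int (a i)" "s1 ''a'' (int m) = int (a m)"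
          unfolding v(2,3) using mn by (simp_all add: vector_def)
        ultimately have "bval s1 ?g \<longleftrightarrow> \<alpha> i < \<alpha> m \<or> \<alpha> i = \<alpha> m \<and> a i < a m"
          using mn by (simp add: i(3) 3(3) v(1))
        then show ?thesis by linarith
      qed
      show ?thesis
      proof (cases "?le m i")
        case True
        then have "\<not> bval s1 ?g" using g by blast
        moreover have "\<forall>q\<in>pos - X. q < Suc i \<longrightarrow> ?le m q" using 3(4) True unfolding nlt by blast
        then have "?I (Suc i) s1" using 3(2,3) by blast
        ultimately show ?thesis by (intro skip)
      next
        case False
        then have b: "bval s1 ?g" using g by blast
        \<comment> \<open>\<open>i\<close> beats \<open>m\<close>, which was minimal among the
          earlier candidates, so by transitivity \<open>i\<close> is minimal now.\<close>
        have "\<forall>q\<in>pos - X. q < Suc i \<longrightarrow> ?le i q"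
          using 3(4) False unfolding nlt by fastforce
        then show ?thesis using b 3(1) by (intro update)
      qed
    qed
  qed (use inp0 in \<open>simp_all add: input_loaded_def s0_def\<close>)
  then have "runs (For ''i'' ''N'' ?body) s0 (86 * ?N) (\<lambda>s'. pos \<subseteq> X \<and> s' ''m'' 0 = int ?N \<or>
    (\<exists>m. is_next X m \<and> s' ''m'' 0 = int m))"
  proof (rule runs_mono)
    fix s' assume s': "?I ?N s'"
    have "q < ?N" if "q \<in> pos - X" for q using that by (auto simp: pos_def)
    then show "pos \<subseteq> X \<and> s' ''m'' 0 = int ?N \<or> (\<exists>m. is_next X m \<and> s' ''m'' 0 = int m)"
      using s' unfolding is_next_def by blast
  qed simp
  moreover have "s ''N'' 0 = int ?N" using inp by (simp add: input_loaded_def)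
  ultimately show ?thesis
    unfolding find_next_def s0_def by (simp del: One_nat_def) (erule runs_mono, simp_all)
qed

lemma runs_clear_lower:
  assumes inp: "input_loaded b \<beta> s" and X: "holds_set X s" and m: "s ''m'' 0 = int m"
    and pos: "X \<subseteq> pos" "m \<in> X"
  shows "runs clear_lower s (62 * Suc n) (holds_set (X - {j. \<alpha> j < \<alpha> m}))"
proof -
  let ?N = "Suc n"
  let ?I = "\<lambda>j s'. \<forall>q<?N. s' ''x'' (int q) = of_bool (q \<in> X \<and> \<not> (q < j \<and> \<alpha> q < \<alpha> m))"
  let ?body = "Cond (Less (elem ''alpha'' ''j'') (elem ''alpha'' ''m'')) (Assign ''x'' (rd ''j'') (Const 0)) Skip"
  have "runs clear_lower s ((40 + 22) * ?N ^ Suc 0) (?I ?N)"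
    unfolding clear_lower_def
  proof (rule runs_For[where I="?I" and N="?N"])
    fix j s1 assume j: "j < ?N" "?I j s1" "s1 ''j'' 0 = int j"
      and fr: "\<And>v. v \<notin> insert ''j'' (writes ?body) \<Longrightarrow> s1 v = s v"
    have v: "s1 ''alpha'' = vector n \<alpha>" "s1 ''m'' 0 = int m"
      using fr[of "''alpha''"] fr[of "''m''"] inp m by (simp_all add: input_loaded_def)
    have mn: "m < n" using pos by (auto simp: pos_def)
    show "runs ?body s1 (40 * ?N ^ 0) (\<lambda>s'. ?I (Suc j) (s'(''j'' := (s' ''j'')(0 := int (Suc j)))))"
    proof (cases "j < n \<and> \<alpha> j < \<alpha> m")
      case True
      then have "bval s1 (Less (elem ''alpha'' ''j'') (elem ''alpha'' ''m''))"
        using mn by (simp add: v j(3) vector_def)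
      then show ?thesis using j(2,3) True by (auto simp: less_Suc_eq)
    next
      case False
      show ?thesis
      proof (cases "j = n")
        case True
        \<comment> \<open>Cell \<open>n\<close> of \<open>alpha\<close> reads 0, so the program
          clears \<open>x[n]\<close>; this is harmless, as \<open>n\<close> is no item and the entry
          is 0 already.\<close>
        then have "j \<notin> X" using pos by (auto simp: pos_def)
        then show ?thesis using j(2,3) True by (auto simp: less_Suc_eq)
      next
        case False
        with \<open>\<not> (j < n \<and> \<alpha> j < \<alpha> m)\<close> j(1)
        have "\<not> bval s1 (Less (elem ''alpha'' ''j'') (elem ''alpha'' ''m''))" "\<not> \<alpha> j < \<alpha> m"
          using mn by (simp_all add: v j(3) vector_def)
        then show ?thesis using j(2,3) by (auto simp: less_Suc_eq)
      qed
    qed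
  qed (use inp X in \<open>simp_all add: input_loaded_def holds_set_def\<close>)
  then show ?thesis by (rule runs_mono) (auto simp: holds_set_def)
qed

lemma runs_advance:
  assumes inp: "input_loaded b \<beta> s" and X: "holds_set X s" and pos: "X \<subseteq> pos"
  shows "runs advance s (170 * Suc n) (\<lambda>s'. pos \<subseteq> X \<and> s' ''go'' 0 = 0 \<or>
    (\<exists>m. is_next X m \<and> holds_set (successor X m) s' \<and> s' ''go'' 0 = s ''go'' 0))"
    (is "runs _ _ _ ?Q")
  unfolding advance_def
proof (rule runs_SeqI[OF runs_frame[OF runs_find_next[OF inp X]]])
  let ?N = "Suc n"
  show "90 * ?N + (62 * ?N + 18) \<le> 170 * ?N" by simp
  fix s1 assume s1: "(pos \<subseteq> X \<and> s1 ''m'' 0 = int ?N \<or> (\<exists>m. is_next X m \<and> s1 ''m'' 0 = int m)) \<and>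
    (\<forall>v. v \<notin> writes find_next \<longrightarrow> s1 v = s v)"
  then have fr: "\<And>v. v \<notin> {''m'', ''i''} \<Longrightarrow> s1 v = s v" by (simp add: writes_find_next)
  have N: "s1 ''N'' 0 = int ?N" using inp by (simp add: fr input_loaded_def)
  let ?rest = "Cond (Equal (rd ''m'') (rd ''N'')) (set_var ''go'' (Const 0))
    (Seq (Assign ''x'' (rd ''m'') (Const 1)) clear_lower)"
  from s1 consider "pos \<subseteq> X" "s1 ''m'' 0 = int ?N" | m where "is_next X m" "s1 ''m'' 0 = int m"
    by blast
  then show "runs ?rest s1 (62 * ?N + 18) ?Q"
  proof cases
    case 1
    then show ?thesis using N by simp
  next
    case (2 m)
    have m: "m < n" "m \<in> pos" using 2(1) by (auto simp: is_next_def pos_def)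
    define s2 where "s2 = s1(''x'' := (s1 ''x'')(int m := 1))"
    have inp2: "input_loaded b \<beta> s2" using inp by (simp add: s2_def fr input_loaded_def)
    have X2: "holds_set (insert m X) s2" using X by (auto simp: s2_def fr holds_set_def)
    have m2: "s2 ''m'' 0 = int m" using 2 by (simp add: s2_def)
    have "runs clear_lower s2 (62 * ?N) ?Q"
    proof (rule runs_mono[OF runs_frame[OF runs_clear_lower[OF inp2 X2 m2]] order_refl])
      fix s' assume s': "holds_set (insert m X - {j. \<alpha> j < \<alpha> m}) s' \<and>
        (\<forall>v. v \<notin> writes clear_lower \<longrightarrow> s' v = s2 v)"
      then have "s' ''go'' = s ''go''" by (simp add: clear_lower_def s2_def fr)
      then show "?Q s'" using s' 2(1) by (auto simp: successor_def)
    qed (use pos m in auto)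
    then have "runs clear_lower s2 (62 * ?N + 8) ?Q" by (rule runs_mono) auto
    then show ?thesis using 2(2) N m by (simp add: s2_def del: One_nat_def)
  qed
qed

section \<open>The enumeration reaches every vector of class counts\<close>

definition covers_below :: "nat set set \<Rightarrow> nat \<Rightarrow> bool" where
  "covers_below V k \<longleftrightarrow> (\<forall>X\<in>V. canonical X) \<and>
    (\<forall>Y\<subseteq>pos. code Y < k \<longrightarrow> (\<exists>X\<in>V. \<forall>v. class_count Y v = class_count X v))"

text \<open>Equal codes mean equal class counts, so one canonical set represents all sets of its
  code and the threshold can move up by one.\<close>

lemma covers_below_insert:
  assumes "covers_below V (code X)" "canonical X"
  shows "covers_below (insert X V) (Suc (code X))"
  unfolding covers_below_def
proof (intro conjI allI impI)
  show "\<forall>X\<in>insert X V. canonical X" using assms by (auto simp: covers_below_def)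
  fix Y assume Y: "Y \<subseteq> pos" "code Y < Suc (code X)"
  show "\<exists>X\<in>insert X V. \<forall>v. class_count Y v = class_count X v"
  proof (cases "code Y = code X")
    case True
    then have "\<forall>v. class_count Y v = class_count X v"
      using class_count_eqI[OF Y(1)] assms(2) by (simp add: canonical_def)
    then show ?thesis by blast
  next
    case False
    then have "code Y < code X" using Y(2) by simp
    then show ?thesis using assms(1) Y(1) unfolding covers_below_def by blast
  qed
qed

lemma covering_if_covers_below: "covers_below V (Suc (code pos)) \<Longrightarrow> covering V"
  unfolding covers_below_def covering_def using code_mono by (auto simp: less_Suc_eq_le)

text \<open>Codes run through 0, 1, 2, ... without gaps, because a step raises the code by exactly
  one. So the sets visited represent every code below the current one, and
  \<open>Suc (code pos) - code X\<close> bounds the rounds left.\<close>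

lemma runs_main_loop:
  assumes inp: "input_loaded b \<beta> s" and X: "holds_set {} s" and Z: "collected b \<beta> {} s"
    and go: "s ''go'' 0 = 1"
  shows "runs (While (Equal (rd ''go'') (Const 1)) (Seq probe_all advance)) s
    (Suc (code pos) * (600 * Suc n ^ 4) + 6)
    (\<lambda>s'. input_loaded b \<beta> s' \<and> s' ''result'' = s ''result'' \<and>
      (\<exists>V. covering V \<and> collected b \<beta> (\<Union>(neighbours ` V)) s'))"
proof -
  let ?N = "Suc n"
  let ?loop = "While (Equal (rd ''go'') (Const 1)) (Seq probe_all advance)"
  let ?J = "\<lambda>k s'. input_loaded b \<beta> s' \<and> s' ''result'' = s ''result'' \<and>
    (\<exists>V. collected b \<beta> (\<Union>(neighbours ` V)) s' \<and>
      (s' ''go'' 0 = 1 \<and> (\<exists>X. canonical X \<and> holds_set X s' \<and> covers_below V (code X) \<and>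
          k = Suc (code pos) - code X) \<or>
       s' ''go'' 0 = 0 \<and> k = 0 \<and> covering V))"
  have init: "?J (Suc (code pos)) s"
    using inp go Z X canonical_empty
    by (intro conjI exI[of _ "{}"]) (auto simp: covers_below_def code_def intro!: exI[of _ "{}"])
  have body: "runs (Seq probe_all advance) s1 (514 * ?N ^ 4) (\<lambda>s'. \<exists>k'<k. ?J k' s')"
    if J: "?J k s1" and g: "bval s1 (Equal (rd ''go'') (Const 1))" for k s1
  proof -
    from J g obtain V X where inp1: "input_loaded b \<beta> s1" and res: "s1 ''result'' = s ''result''"
      and V: "collected b \<beta> (\<Union>(neighbours ` V)) s1" "covers_below V (code X)"
      and go1: "s1 ''go'' 0 = 1" and X1: "canonical X" "holds_set X s1" and k: "k = Suc (code pos) - code X"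
      by auto
    have Xpos: "X \<subseteq> pos" using X1 by (simp add: canonical_def)
    have Z': "\<Union>(neighbours ` V) \<union> neighbours X = \<Union>(neighbours ` insert X V)" by auto
    show ?thesis
    proof (rule runs_SeqI[OF runs_frame[OF runs_probe_all[OF inp1 X1(2) V(1)]]])
      have "?N \<le> ?N ^ 4" by (simp add: self_le_power)
      moreover have "344 * x + 170 * y \<le> 514 * x" if "y \<le> x" for x y :: nat using that by linarith
      ultimately show "344 * ?N ^ 4 + 170 * ?N \<le> 514 * ?N ^ 4" by blast
      fix s2 assume "collected b \<beta> (\<Union>(neighbours ` V) \<union> neighbours X) s2 \<and>
        (\<forall>v. v \<notin> writes probe_all \<longrightarrow> s2 v = s1 v)"
      then have Z2: "collected b \<beta> (\<Union>(neighbours ` insert X V)) s2"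
        and fr2: "\<And>v. v \<notin> writes probe_all \<Longrightarrow> s2 v = s1 v" unfolding Z' by blast+
      have inp2: "input_loaded b \<beta> s2"
        by (rule input_loaded_frame[OF inp1, where A="writes probe_all"])
          (simp_all add: fr2 writes_probe_all)
      have X2: "holds_set X s2" and go2: "s2 ''go'' 0 = 1"
        using X1(2) go1 by (simp_all add: holds_set_def fr2 writes_probe_all)
      show "runs advance s2 (170 * ?N) (\<lambda>s'. \<exists>k'<k. ?J k' s')"
      proof (rule runs_mono[OF runs_frame[OF runs_advance[OF inp2 X2 Xpos]] order_refl])
        fix s' assume s': "(pos \<subseteq> X \<and> s' ''go'' 0 = 0 \<or>
          (\<exists>m. is_next X m \<and> holds_set (successor X m) s' \<and> s' ''go'' 0 = s2 ''go'' 0)) \<and>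
          (\<forall>v. v \<notin> writes advance \<longrightarrow> s' v = s2 v)"
        then have fr: "\<And>v. v \<notin> writes advance \<Longrightarrow> s' v = s2 v" by blast
        have inp': "input_loaded b \<beta> s'"
          by (rule input_loaded_frame[OF inp2, where A="writes advance"]) (simp_all add: fr writes_advance)
        have col': "collected b \<beta> (\<Union>(neighbours ` insert X V)) s'"
          by (rule collected_frame[OF Z2]) (simp_all add: fr writes_advance)
        have res': "s' ''result'' = s ''result''"
          using res by (simp add: fr fr2 writes_advance writes_probe_all)
        have cov: "covers_below (insert X V) (Suc (code X))"
          by (rule covers_below_insert[OF V(2) X1(1)])
        have kpos: "0 < k" using code_mono[OF Xpos] k by simp
        from s' consider "pos \<subseteq> X" "s' ''go'' 0 = 0"
          | m where "is_next X m" "holds_set (successor X m) s'" "s' ''go'' 0 = 1"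
          using go2 by auto
        then show "\<exists>k'<k. ?J k' s'"
        proof cases
          case 1
          \<comment> \<open>With no positive item missing the numeral is the largest one, so every
            code has been represented.\<close>
          then have "X = pos" using Xpos by simp
          then have "covering (insert X V)" using cov covering_if_covers_below by simp
          then have "?J 0 s'" using inp' res' col' 1(2) by blast
          then show ?thesis using kpos by blast
        next
          case (2 m)
          let ?X = "successor X m"
          have can: "canonical ?X" using canonical_successor[OF X1(1) 2(1)] .
          have code: "code ?X = Suc (code X)" using code_successor[OF Xpos 2(1)] .
          have "code ?X \<le> code pos" using can by (intro code_mono) (simp add: canonical_def)
          then have "Suc (code pos) - code ?X < k" using k code by simp
          moreover have "?J (Suc (code pos) - code ?X) s'"
            using inp' res' col' 2 can cov code by metis
          ultimately show ?thesis by blast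
        qed
      qed
    qed
  qed
  have "runs ?loop s (Suc (code pos) * (514 * ?N ^ 4 + bcost (Equal (rd ''go'') (Const 1)) + 1) +
      bcost (Equal (rd ''go'') (Const 1)) + 1)
    (\<lambda>s'. (\<exists>k. ?J k s') \<and> \<not> bval s' (Equal (rd ''go'') (Const 1)))"
    by (rule runs_WhileI[where I="?J"]) (use init body in auto)
  then show ?thesis
  proof (rule runs_mono)
    \<comment> \<open>514 is 344 for the neighbours plus 170 for the step to the next set; the rise
      to 600 absorbs the loop test.\<close>
    have le: "514 * x + 4 + 1 \<le> 600 * x" if "1 \<le> x" for x :: nat using that by linarith
    have "514 * ?N ^ 4 + 4 + 1 \<le> 600 * ?N ^ 4" by (rule le) simp
    then have "Suc (code pos) * (514 * ?N ^ 4 + 4 + 1) \<le> Suc (code pos) * (600 * ?N ^ 4)"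
      by (rule mult_le_mono2)
    moreover have "x + 4 + 1 \<le> y + 6" if "x \<le> y" for x y :: nat using that by linarith
    moreover have "bcost (Equal (rd ''go'') (Const 1)) = 4" by simp
    ultimately show "Suc (code pos) * (514 * ?N ^ 4 + bcost (Equal (rd ''go'') (Const 1)) + 1) +
      bcost (Equal (rd ''go'') (Const 1)) + 1 \<le> Suc (code pos) * (600 * ?N ^ 4) + 6" by metis
  qed auto
qed

lemma runs_facet_program:
  assumes "1 \<le> n" and ab: "\<And>i. i < n \<Longrightarrow> a i \<le> b"
  shows "runs facet_program (input_state n a b \<alpha> \<beta>) (20000 * n ^ (num_pos_values n \<alpha> + 4))
    (\<lambda>s. output_of s = (if facet_defining n \<alpha> \<beta> (knapsack_polytope n a b) then 1 else 0))"
    (is "runs _ ?s _ ?Q")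
proof -
  let ?N = "Suc n"
  define s0 where "s0 = ?s(''N'' := (?s ''N'')(0 := int ?N), ''valid'' := (?s ''valid'')(0 := 1),
    ''go'' := (?s ''go'')(0 := 1))"
  have inp: "input_loaded b \<beta> s0" and X: "holds_set {} s0" and go: "s0 ''go'' 0 = 1"
    by (simp_all add: s0_def input_loaded_def holds_set_def input_state_def scalar_def)
  have mat: "matrix_of ?N s0 = (\<lambda>_ _. 0)"
    by (simp add: fun_eq_iff matrix_of_def s0_def input_state_def)
  \<comment> \<open>Memory starts at 0, which already is the echelon matrix of rank 0 for the empty
    family.\<close>
  have "echelon ?N (matrix_of ?N s0) 0" by (simp add: mat echelon_def)
  moreover have "span ((\<lambda>p. int_vec ?N (matrix_of ?N s0 p)) ` {..<?N}) = span (lifted_char_vec n ` {})"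
  proof -
    have "(\<lambda>p. int_vec ?N (matrix_of ?N s0 p)) ` {..<?N} = {0}" by (auto simp: mat int_vec_0)
    then show ?thesis by simp
  qed
  ultimately have Z: "collected b \<beta> {} s0"
    unfolding collected_def by (simp add: s0_def input_state_def)
  let ?fin = "Cond (Conj (Equal (rd ''valid'') (Const 1)) (Equal (rd ''rank'') (rd ''n'')))
      (set_var ''result'' (Const 1)) Skip"
  let ?T = "Suc (code pos) * (600 * ?N ^ 4)"
  have "runs (Seq (While (Equal (rd ''go'') (Const 1)) (Seq probe_all advance)) ?fin) s0 (?T + 26) ?Q"
  proof (rule runs_SeqI[OF runs_main_loop[OF inp X Z go]])
    fix s assume s: "input_loaded b \<beta> s \<and> s ''result'' = s0 ''result'' \<and>
      (\<exists>V. covering V \<and> collected b \<beta> (\<Union>(neighbours ` V)) s)"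
    then obtain V where V: "covering V" "collected b \<beta> (\<Union>(neighbours ` V)) s" by blast
    have res: "s ''result'' 0 = 0" using s by (simp add: s0_def input_state_def)
    have valid: "s ''valid'' 0 = of_bool (\<forall>Y\<in>feasible_sets n a b. sum \<alpha> Y \<le> \<beta>)"
      using V(2) unfolding covering_valid[OF V(1)] collected_def by blast
    from V(2) obtain r where r: "echelon ?N (matrix_of ?N s) r" "s ''rank'' 0 = int r"
      "span ((\<lambda>p. int_vec ?N (matrix_of ?N s p)) ` {..<?N}) =
        span (lifted_char_vec n ` {Y \<in> feasible_sets n a b. sum \<alpha> Y = \<beta>})"
      unfolding collected_def covering_span[OF V(1)] by blast
    have "dim (lifted_char_vec n ` {Y \<in> feasible_sets n a b. sum \<alpha> Y = \<beta>}) = r"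
      using echelon_dim[OF r(1)] unfolding r(3) by (simp only: dim_span)
    then have "facet_defining n \<alpha> \<beta> (knapsack_polytope n a b) \<longleftrightarrow> s ''valid'' 0 = 1 \<and> s ''rank'' 0 = s ''n'' 0"
      using facet_defining_iff[OF ab] s valid r(2) by (simp add: input_loaded_def)
    then show "runs ?fin s 20 ?Q"
      using res by (simp add: output_of_def)
  qed simp
  moreover have "?s ''n'' 0 = int n" by (simp add: input_state_def scalar_def)
  ultimately have "runs facet_program ?s (?T + 46) ?Q"
    unfolding facet_program_def s0_def
    by (simp add: add.commute del: One_nat_def split del: if_split) (erule runs_mono, simp_all)
  then show ?thesis
  proof (rule runs_mono)
    let ?K = "num_pos_values n \<alpha>"
    \<comment> \<open>With \<open>n + 1 \<le> 2 * n\<close> the constant becomes 2 * 600 * 16 =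
      19200; the remaining 800 cover setup and final test.\<close>
    have "?N ^ 4 \<le> (2 * n) ^ 4" using assms by (intro power_mono) auto
    then have "?T \<le> (2 * n ^ ?K) * (600 * (2 * n) ^ 4)"
      using Suc_code_pos_le[OF assms(1)] by (intro mult_le_mono) auto
    also have "\<dots> = 19200 * n ^ (?K + 4)" by (simp add: power_mult_distrib power_add)
    finally have "?T \<le> 19200 * n ^ (?K + 4)" .
    moreover have "1 \<le> n ^ (?K + 4)" using assms by simp
    ultimately show "?T + 46 \<le> 20000 * n ^ (?K + 4)" by linarith
  qed
qed

end

text \<open>Execution is deterministic, so the run that is shown to exist is the only one. The
  additive 4 in the exponent comes from a quadratic number of pairs of flips, each with a quadratic
  insertion into the matrix.\<close>

theorem theorem6:
  shows "\<exists>(prog :: com) (C :: nat) (c :: nat).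
    \<forall>(n :: nat) (a :: nat \<Rightarrow> nat) (b :: nat) (\<alpha> :: nat \<Rightarrow> nat) (\<beta> :: nat).
      n \<ge> 1 \<and> b \<ge> 1 \<and> (\<forall>i<n. 1 \<le> a i \<and> a i \<le> b) \<longrightarrow>
      (\<exists>t s. exec prog (input_state n a b \<alpha> \<beta>) t s
         \<and> output_of s = (if facet_defining n \<alpha> \<beta> (knapsack_polytope n a b) then 1 else 0)
         \<and> t \<le> C * n ^ (num_pos_values n \<alpha> + c))"
proof (rule exI[of _ facet_program], rule exI[of _ 20000], rule exI[of _ 4], intro allI impI)
  fix n b \<beta> :: nat and a \<alpha> :: "nat \<Rightarrow> nat"
  assume *: "n \<ge> 1 \<and> b \<ge> 1 \<and> (\<forall>i<n. 1 \<le> a i \<and> a i \<le> b)"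
  interpret knapsack n a \<alpha> .
  from * have "runs facet_program (input_state n a b \<alpha> \<beta>) (20000 * n ^ (num_pos_values n \<alpha> + 4))
    (\<lambda>s. output_of s = (if facet_defining n \<alpha> \<beta> (knapsack_polytope n a b) then 1 else 0))"
    by (intro runs_facet_program) auto
  then show "\<exists>t s. exec facet_program (input_state n a b \<alpha> \<beta>) t s
      \<and> output_of s = (if facet_defining n \<alpha> \<beta> (knapsack_polytope n a b) then 1 else 0)
      \<and> t \<le> 20000 * n ^ (num_pos_values n \<alpha> + 4)"
    unfolding runs_def by blast
qed

end
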